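(* Let $p>1$, $\frac1p+\frac1q=1$, $2<\alpha\le 3$, $\eta\in(0,1)$. Let $f\in C([0,1]\times[0,\infty),[0,\infty))$ with $f(t,0)\not\equiv 0$ on $[0,1]$, and let $a\in C([0,1],[0,\infty))$ with $a(t)\not\equiv0$ on any subinterval of $[0,1]$. Let $\Phi(s)=\frac{(\alpha-s)(1-s)^{\alpha-2}}{\Gamma(\alpha)}$. Assume that there exists a constant $\nu>0$ such that $$\nu>L^{q-1}\varphi_q\Big(\int_0^1a(\tau)\,d\tau\Big)\int_0^1\Phi(s)\,ds,\qquad\text{where } L=\max\{f(t,u):(t,u)\in[0,1]\times[0,\nu]\}.$$ Then the boundary value problem $$\big(\varphi_p(D^\alpha u(t))\big)'+a(t)f(t,u(t))=0,\quad t\in(0,1),$$ $$D^\alpha u(0)=u'(0)=u''(0)=0,\qquad u(1)+u'(1)=u'(\eta),$$ has at least one positive solution.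
   Context: $\varphi_p(s)=|s|^{p-2}s$ is the $p$-Laplacian operator, and $\varphi_q=\varphi_p^{-1}$ with $\frac1p+\frac1q=1$. $\Gamma$ is the gamma function. $D^\alpha$ is the standard Caputo derivative of order $\alpha$: for an at least $n$-times continuously differentiable function $g$, $D^\alpha g(t)=\frac{1}{\Gamma(n-\alpha)}\int_0^t\frac{g^{(n)}(s)}{(t-s)^{\alpha+1-n}}\,ds$, $n-1<\alpha<n$, $n=[\alpha]+1$, where $[\alpha]$ is the integer part of $\alpha$. A positive solution of the boundary value problem is a solution $u$ with $u\in C([0,1])$ and $u(t)>0$ for all $t\in(0,1)$.
   Formalization: For 2<α<3 a solution need not be three times continuously differentiable (such solutions can fail to exist): u'' is only absolutely continuous, with D^α u given by the same formula, absolutely convergent and continuous on [0,1]; for α=3, D^α u is u'''. *)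

theory Defs
  imports "HOL-Analysis.Analysis"
begin

definition plap :: "real \<Rightarrow> real \<Rightarrow> real" where
  "plap p s = \<bar>s\<bar> powr (p - 2) * s"

(* Derivatives are taken within [0,1], hence one-sided at the end points; the values of a
   function outside [0,1] are irrelevant. *)
definition nderiv :: "nat \<Rightarrow> (real \<Rightarrow> real) \<Rightarrow> real \<Rightarrow> real" where
  "nderiv k = (\<lambda>g t. vector_derivative g (at t within {0..1})) ^^ k"

(* The members k = [c,d] of a division are nonempty closed intervals: Inf k = c and Sup k = d. *)
definition abs_continuous_on :: "real \<Rightarrow> real \<Rightarrow> (real \<Rightarrow> real) \<Rightarrow> bool" where
  "abs_continuous_on a b g \<longleftrightarrow>
     (\<forall>\<epsilon>>0. \<exists>\<delta>>0. \<forall>\<D> T. \<D> division_of T \<and> T \<subseteq> {a..b} \<and> (\<Sum>k\<in>\<D>. Sup k - Inf k) < \<delta>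
        \<longrightarrow> (\<Sum>k\<in>\<D>. \<bar>g (Sup k) - g (Inf k)\<bar>) < \<epsilon>)"

(* The integrand of the Caputo integral for non-integer order; here n = [\<alpha>] + 1. *)
definition caputo_integrand :: "real \<Rightarrow> (real \<Rightarrow> real) \<Rightarrow> real \<Rightarrow> real \<Rightarrow> real" where
  "caputo_integrand \<alpha> g t s =
     (let n = nat \<lfloor>\<alpha>\<rfloor> + 1 in nderiv n g s / (t - s) powr (\<alpha> + 1 - real n))"

(* Caputo derivative on [0,1] with base point 0. At an integer order, which the integral formula
   (stated for n - 1 < \<alpha> < n) leaves out, it is by the usual convention the ordinary derivative. *)
definition caputo :: "real \<Rightarrow> (real \<Rightarrow> real) \<Rightarrow> real \<Rightarrow> real" where
  "caputo \<alpha> g t =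
     (if \<alpha> \<in> \<int> then nderiv (nat \<lfloor>\<alpha>\<rfloor>) g t
      else 1 / Gamma (real (nat \<lfloor>\<alpha>\<rfloor> + 1) - \<alpha>) * integral {0..t} (caputo_integrand \<alpha> g t))"

(* The class of functions for which the Caputo derivative makes sense everywhere on [0,1]: for
   non-integer order, g is in AC^n[0,1] (g^(n-1) exists and is absolutely continuous, so that
   g^(n) exists a.e.) and the Caputo integral converges absolutely for every t. Every C^n function
   qualifies, but C^n itself would be too small for the boundary value problem: if q < 2,
   then \<phi>_q vanishes at 0 with an infinite derivative, and the n-th derivative of the solution may
   have an integrable singularity. *)
definition caputo_differentiable :: "real \<Rightarrow> (real \<Rightarrow> real) \<Rightarrow> bool" where
  "caputo_differentiable \<alpha> g \<longleftrightarrow>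
     (let m = nat \<lfloor>\<alpha>\<rfloor> in
       (\<forall>k<m. nderiv k g differentiable_on {0..1}) \<and>
       (\<alpha> \<notin> \<int> \<longrightarrow>
          abs_continuous_on 0 1 (nderiv m g) \<and>
          (\<forall>t\<in>{0..1}. caputo_integrand \<alpha> g t absolutely_integrable_on {0..t})))"

(* Continuity of D^\<alpha> u on [0,1] is part of the notion of solution: for non-integer \<alpha> the Caputo
   integral is 0 at t = 0 by definition, so D^\<alpha> u(0) = 0 is a genuine condition only together with
   continuity. *)
definition bvp_solution ::
  "real \<Rightarrow> real \<Rightarrow> real \<Rightarrow> (real \<Rightarrow> real \<Rightarrow> real) \<Rightarrow> (real \<Rightarrow> real) \<Rightarrow> (real \<Rightarrow> real) \<Rightarrow> bool"
  where
  "bvp_solution p \<alpha> \<eta> f a u \<longleftrightarrow>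
     caputo_differentiable \<alpha> u \<and>
     continuous_on {0..1} (caputo \<alpha> u) \<and>
     (\<forall>t\<in>{0<..<1}. (\<lambda>s. plap p (caputo \<alpha> u s)) differentiable at t \<and>
        deriv (\<lambda>s. plap p (caputo \<alpha> u s)) t + a t * f t (u t) = 0) \<and>
     caputo \<alpha> u 0 = 0 \<and> nderiv 1 u 0 = 0 \<and> nderiv 2 u 0 = 0 \<and>
     u 1 + nderiv 1 u 1 = nderiv 1 u \<eta>"

definition positive_bvp_solution ::
  "real \<Rightarrow> real \<Rightarrow> real \<Rightarrow> (real \<Rightarrow> real \<Rightarrow> real) \<Rightarrow> (real \<Rightarrow> real) \<Rightarrow> (real \<Rightarrow> real) \<Rightarrow> bool"
  where
  "positive_bvp_solution p \<alpha> \<eta> f a u \<longleftrightarrow>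
     bvp_solution p \<alpha> \<eta> f a u \<and> continuous_on {0..1} u \<and> (\<forall>t\<in>{0<..<1}. u t > 0)"

definition \<Phi> :: "real \<Rightarrow> real \<Rightarrow> real" where
  "\<Phi> \<alpha> s = (\<alpha> - s) * (1 - s) powr (\<alpha> - 2) / Gamma \<alpha>"

end

theory Submission
  imports Defs "HOL-Complex_Analysis.Great_Picard"
begin

text \<open>
  With \<open>h u t = \<phi>\<^sub>q (\<integral>\<^sub>0\<^sup>t a f(\<tau>, u))\<close> and \<open>I\<^sup>\<beta>\<close> the Riemann--Liouville integral, the problem is the
  fixed point equation \<open>u = G u - I\<^sup>\<alpha> (h u)\<close> where the boundary condition forces
  \<open>G u = I\<^sup>\<alpha> (h u) 1 + I\<^sup>\<alpha>\<^sup>-\<^sup>1 (h u) 1 - I\<^sup>\<alpha>\<^sup>-\<^sup>1 (h u) \<eta>\<close>, and the hypothesis on \<open>\<nu>\<close> keeps \<open>G u\<close> in \<open>[0, \<nu>]\<close>.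
  Schauder's theorem is avoided: since \<open>I\<^sup>\<alpha> (h u) t\<close> depends only on \<open>u\<close> on \<open>[0, t]\<close>, the delayed equation
  \<open>u t = c - I\<^sup>\<alpha> (h u) (t - 1/n)\<close> has an explicit solution depending continuously on the number \<open>c\<close>;
  the intermediate value theorem yields \<open>c = G u\<close>, and Arzela--Ascoli lets \<open>n\<close> tend to infinity.
  For \<open>\<alpha> < 3\<close> the function \<open>h = h u\<close> is the integral of some \<open>g \<ge> 0\<close> that may be unbounded, so
  \<open>u'' = - I\<^sup>1 I\<^sup>\<alpha>\<^sup>-\<^sup>2 g\<close> is absolutely continuous and \<open>u''' = - I\<^sup>\<alpha>\<^sup>-\<^sup>2 g\<close> almost everywhere; the semigroup law
  \<open>I\<^sup>3\<^sup>-\<^sup>\<alpha> I\<^sup>\<alpha>\<^sup>-\<^sup>2 g = I\<^sup>1 g = h\<close> then computes the Caputo derivative.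
\<close>

section \<open>Riemann--Liouville integrals\<close>

text \<open>Cutting the kernel off at 0 turns the Riemann--Liouville integral into a convolution
  over the whole line. In \<open>rl_nn\<close> everything is \<open>ennreal\<close>-valued, so
  Tonelli applies without integrability side conditions.\<close>

definition rl_kernel :: "real \<Rightarrow> real \<Rightarrow> real" where
  "rl_kernel \<beta> x = (if 0 < x then x powr (\<beta> - 1) / Gamma \<beta> else 0)"

definition rl_nn :: "real \<Rightarrow> (real \<Rightarrow> ennreal) \<Rightarrow> real \<Rightarrow> ennreal" where
  "rl_nn \<beta> G t = (\<integral>\<^sup>+x. ennreal (rl_kernel \<beta> x) * G (t - x) \<partial>lborel)"

lemma rl_kernel_nonneg [simp]: "\<beta> > 0 \<Longrightarrow> 0 \<le> rl_kernel \<beta> x"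
  by (simp add: rl_kernel_def less_imp_le[OF Gamma_real_pos])

lemma rl_kernel_one: "rl_kernel 1 x = (if 0 < x then 1 else 0)"
  by (simp add: rl_kernel_def)

lemma measurable_rl_kernel [measurable]: "rl_kernel \<beta> \<in> borel_measurable borel"
  unfolding rl_kernel_def[abs_def] by measurable

lemma measurable_rl_nn [measurable]:
  assumes [measurable]: "G \<in> borel_measurable borel"
  shows "rl_nn \<beta> G \<in> borel_measurable borel"
  unfolding rl_nn_def[abs_def] by measurable

text \<open>The substitution \<open>x = t * y\<close> reduces the convolution to Euler's Beta
  integral, and \<open>Beta \<beta> \<gamma>\<close> equals
  \<open>Gamma \<beta> * Gamma \<gamma> / Gamma (\<beta> + \<gamma>)\<close>.\<close>

lemma rl_kernel_convolution:
  assumes "\<beta> > 0" "\<gamma> > 0"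
  shows "(\<integral>\<^sup>+x. ennreal (rl_kernel \<beta> x) * ennreal (rl_kernel \<gamma> (t - x)) \<partial>lborel)
           = ennreal (rl_kernel (\<beta> + \<gamma>) t)"
proof (cases "t > 0")
  case False
  then have "ennreal (rl_kernel \<beta> x) * ennreal (rl_kernel \<gamma> (t - x)) = 0" for x
    by (cases "x > 0") (auto simp: rl_kernel_def)
  then show ?thesis using False by (simp only: nn_integral_const) (simp add: rl_kernel_def)
next
  case True
  define b where "b y = (if y \<in> {0<..<1} then y powr (\<beta> - 1) * (1 - y) powr (\<gamma> - 1) else 0)" for y :: real
  have b_nonneg: "0 \<le> b y" for y by (simp add: b_def)
  have [measurable]: "b \<in> borel_measurable borel"
    unfolding b_def[abs_def] by measurable
  have "((\<lambda>x. x powr (\<beta>-1) * (1 - x) powr (\<gamma>-1)) has_integral Beta \<beta> \<gamma>) {0<..<1}"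
    using has_integral_Beta_real[OF assms] by (simp add: has_integral_Icc_iff_Ioo)
  then have "(b has_integral Beta \<beta> \<gamma>) UNIV"
    unfolding b_def by (rule has_integral_restrict_UNIV[THEN iffD2])
  then have int_b: "(\<integral>\<^sup>+y. ennreal (b y) \<partial>lborel) = ennreal (Beta \<beta> \<gamma>)"
    by (intro nn_integral_has_integral_lborel) (auto simp: b_nonneg)
  \<comment> \<open>This constant gathers what the two kernels leave behind after rescaling; the
    further factor \<open>t\<close> is the Jacobian.\<close>
  define c where "c = t powr (\<beta> + \<gamma> - 2) / (Gamma \<beta> * Gamma \<gamma>)"
  have G: "Gamma \<beta> > 0" "Gamma \<gamma> > 0" "Gamma (\<beta> + \<gamma>) > 0" using assms by auto
  have c: "c \<ge> 0" using G by (simp add: c_def)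
  have eq: "rl_kernel \<beta> (t * y) * rl_kernel \<gamma> (t - t * y) = c * b y" for y
  proof (cases "y \<in> {0<..<1}")
    case True': True
    have "t - t * y = t * (1 - y)" by (simp add: algebra_simps)
    moreover have "t powr (\<beta> + \<gamma> - 2) = t powr (\<beta> - 1) * t powr (\<gamma> - 1)"
      by (simp add: powr_add[symmetric])
    ultimately show ?thesis using True' \<open>t > 0\<close>
      by (simp add: rl_kernel_def b_def c_def powr_mult)
  next
    case False
    then have "\<not> (0 < t * y \<and> 0 < t - t * y)"
      using True by (auto simp: zero_less_mult_iff)
    with False show ?thesis by (auto simp: rl_kernel_def b_def)
  qed
  have "(\<integral>\<^sup>+x. ennreal (rl_kernel \<beta> x) * ennreal (rl_kernel \<gamma> (t - x)) \<partial>lborel)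
      = ennreal t * (\<integral>\<^sup>+y. ennreal (rl_kernel \<beta> (t * y)) * ennreal (rl_kernel \<gamma> (t - t * y)) \<partial>lborel)"
    using True by (subst nn_integral_real_affine[where c = t and t = 0]) auto
  also have "\<dots> = ennreal t * (\<integral>\<^sup>+y. ennreal c * ennreal (b y) \<partial>lborel)"
    using assms c by (simp add: ennreal_mult[symmetric] eq b_nonneg)
  also have "\<dots> = ennreal (t * (c * Beta \<beta> \<gamma>))"
  proof -
    have "Beta \<beta> \<gamma> \<ge> 0" using G by (simp add: Beta_def)
    with c True show ?thesis by (subst nn_integral_cmult) (auto simp: int_b ennreal_mult)
  qed
  also have "t * (c * Beta \<beta> \<gamma>) = rl_kernel (\<beta> + \<gamma>) t"
    using True G by (simp add: c_def Beta_def rl_kernel_def powr_diff powr_add power2_eq_square)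
  finally show ?thesis .
qed

text \<open>Semigroup law: convolution is associative by Tonelli, and the two kernels merge by
  \<open>rl_kernel_convolution\<close>.\<close>

lemma rl_nn_rl_nn:
  assumes "\<beta> > 0" "\<gamma> > 0" and [measurable]: "G \<in> borel_measurable borel"
  shows "rl_nn \<beta> (rl_nn \<gamma> G) t = rl_nn (\<beta> + \<gamma>) G t"
proof -
  have "rl_nn \<beta> (rl_nn \<gamma> G) t
      = (\<integral>\<^sup>+x. ennreal (rl_kernel \<beta> x) * (\<integral>\<^sup>+y. ennreal (rl_kernel \<gamma> (y - x)) * G (t - y) \<partial>lborel) \<partial>lborel)"
    unfolding rl_nn_def
  proof (rule nn_integral_cong, rule arg_cong2[where f = "(*)", OF refl])
    fix x :: real
    show "(\<integral>\<^sup>+y. ennreal (rl_kernel \<gamma> y) * G (t - x - y) \<partial>lborel)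
        = (\<integral>\<^sup>+y. ennreal (rl_kernel \<gamma> (y - x)) * G (t - y) \<partial>lborel)"
      by (subst nn_integral_real_affine[where c = 1 and t = "-x"]) (auto simp: algebra_simps)
  qed
  also have "\<dots> = (\<integral>\<^sup>+x. (\<integral>\<^sup>+y. ennreal (rl_kernel \<beta> x) * (ennreal (rl_kernel \<gamma> (y - x)) * G (t - y)) \<partial>lborel) \<partial>lborel)"
    by (subst nn_integral_cmult) auto
  also have "\<dots> = (\<integral>\<^sup>+y. (\<integral>\<^sup>+x. ennreal (rl_kernel \<beta> x) * (ennreal (rl_kernel \<gamma> (y - x)) * G (t - y)) \<partial>lborel) \<partial>lborel)"
    by (rule lborel_pair.Fubini') measurable
  also have "\<dots> = (\<integral>\<^sup>+y. (\<integral>\<^sup>+x. ennreal (rl_kernel \<beta> x) * ennreal (rl_kernel \<gamma> (y - x)) \<partial>lborel) * G (t - y) \<partial>lborel)"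
    by (subst nn_integral_multc[symmetric]) (auto simp: mult.assoc)
  also have "\<dots> = rl_nn (\<beta> + \<gamma>) G t"
    by (simp add: rl_kernel_convolution assms rl_nn_def)
  finally show ?thesis .
qed

lemma rl_nn_reflect:
  assumes [measurable]: "G \<in> borel_measurable borel"
  shows "rl_nn \<beta> G t = (\<integral>\<^sup>+s. ennreal (rl_kernel \<beta> (t - s)) * G s \<partial>lborel)"
  unfolding rl_nn_def
  by (subst nn_integral_real_affine[where c = "-1" and t = t]) auto

lemma rl_nn_one:
  assumes [measurable]: "G \<in> borel_measurable borel" and "\<And>s. s < 0 \<Longrightarrow> G s = 0"
  shows "rl_nn 1 G t = (\<integral>\<^sup>+s. G s * indicator {0..t} s \<partial>lborel)"
  unfolding rl_nn_reflect[OF assms(1)]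
proof (rule nn_integral_cong_AE)
  \<comment> \<open>At \<open>s = t\<close> the cut-off kernel is 0 while the indicator is 1, so the
    integrands agree only almost everywhere.\<close>
  show "AE s in lborel. ennreal (rl_kernel 1 (t - s)) * G s = G s * indicator {0..t} s"
    using AE_lborel_singleton[of t]
  proof eventually_elim
    case (elim s)
    then show ?case by (cases "s < 0") (auto simp: indicator_def rl_kernel_one assms(2))
  qed
qed

lemma rl_nn_cong:
  assumes "\<And>x. x < t \<Longrightarrow> G x = G' x"
  shows "rl_nn \<beta> G t = rl_nn \<beta> G' t"
  unfolding rl_nn_def
  by (intro nn_integral_cong) (auto simp: rl_kernel_def assms)

lemma rl_nn_mono:
  assumes "\<And>x. x < t \<Longrightarrow> G x \<le> G' x"
  shows "rl_nn \<beta> G t \<le> rl_nn \<beta> G' t"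
  unfolding rl_nn_def
  by (intro nn_integral_mono) (auto simp: rl_kernel_def assms mult_left_mono)

text \<open>The indicator of the positive half-line is the kernel of order 1, so this is one more
  kernel convolution.\<close>

lemma rl_nn_indicator:
  assumes "\<beta> > 0" "M \<ge> 0"
  shows "rl_nn \<beta> (\<lambda>x. ennreal M * indicator {0<..} x) t = ennreal (M * rl_kernel (\<beta> + 1) t)"
proof -
  have "rl_nn \<beta> (\<lambda>x. ennreal M * indicator {0<..} x) t
     = (\<integral>\<^sup>+x. ennreal M * (ennreal (rl_kernel \<beta> x) * ennreal (rl_kernel 1 (t - x))) \<partial>lborel)"
    unfolding rl_nn_def
    by (intro nn_integral_cong) (auto simp: rl_kernel_one indicator_def ac_simps)
  also have "\<dots> = ennreal (M * rl_kernel (\<beta> + 1) t)"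
    using assms by (subst nn_integral_cmult) (auto simp: rl_kernel_convolution ennreal_mult)
  finally show ?thesis .
qed

text \<open>The majorant is integrable because the reflected indicator confines \<open>x\<close> to
  values below \<open>t - a\<close>. Support bounds \<open>a\<close> other than 0 occur for the
  translates in \<open>causal_rl_integral\<close>.\<close>

lemma rl_nn_dominated_convergence:
  fixes t :: real
  assumes "\<beta> > 0" "M \<ge> 0"
    and [measurable]: "\<And>n. G n \<in> borel_measurable borel" "G' \<in> borel_measurable borel"
    and bound: "\<And>n x. x < t \<Longrightarrow> G n x \<le> ennreal M * indicator {a<..} x"
    and lim: "\<And>x. x < t \<Longrightarrow> (\<lambda>n. G n x) \<longlonglongrightarrow> G' x"
  shows "(\<lambda>n. rl_nn \<beta> (G n) t) \<longlonglongrightarrow> rl_nn \<beta> G' t"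
  unfolding rl_nn_def
proof (rule nn_integral_dominated_convergence[where w = "\<lambda>x. ennreal (rl_kernel \<beta> x) * (ennreal M * indicator {a<..} (t - x))"])
  have "(\<integral>\<^sup>+x. ennreal (rl_kernel \<beta> x) * (ennreal M * indicator {a<..} (t - x)) \<partial>lborel)
      = rl_nn \<beta> (\<lambda>x. ennreal M * indicator {0<..} x) (t - a)"
    unfolding rl_nn_def by (intro nn_integral_cong) (auto simp: indicator_def)
  then show "(\<integral>\<^sup>+x. ennreal (rl_kernel \<beta> x) * (ennreal M * indicator {a<..} (t - x)) \<partial>lborel) < \<infinity>"
    using assms(1,2) by (simp add: rl_nn_indicator)
  show "AE x in lborel. ennreal (rl_kernel \<beta> x) * G n (t - x)
          \<le> ennreal (rl_kernel \<beta> x) * (ennreal M * indicator {a<..} (t - x))" for n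
    by (rule AE_I2) (auto simp: rl_kernel_def bound mult_left_mono)
  show "AE x in lborel. (\<lambda>n. ennreal (rl_kernel \<beta> x) * G n (t - x)) \<longlonglongrightarrow> ennreal (rl_kernel \<beta> x) * G' (t - x)"
  proof (rule AE_I2)
    fix x
    show "(\<lambda>n. ennreal (rl_kernel \<beta> x) * G n (t - x)) \<longlonglongrightarrow> ennreal (rl_kernel \<beta> x) * G' (t - x)"
    \<comment> \<open>Multiplication on \<open>ennreal\<close> is discontinuous at 0 times infinity.
      A positive finite kernel value excludes this case, and where the kernel is 0 the products are
      constantly 0.\<close>
    proof (cases "x > 0")
      case True
      moreover from this have "rl_kernel \<beta> x > 0"
        using Gamma_real_pos[OF assms(1)] by (simp add: rl_kernel_def)
      ultimately show ?thesis by (intro tendsto_mult_ennreal lim tendsto_const) auto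
    qed (simp add: rl_kernel_def)
  qed
qed measurable

section \<open>Real-valued integrals of causal functions\<close>

definition rl_integral :: "real \<Rightarrow> (real \<Rightarrow> real) \<Rightarrow> real \<Rightarrow> real" where
  "rl_integral \<beta> h t = enn2real (rl_nn \<beta> (\<lambda>x. ennreal (h x)) t)"

text \<open>Vanishing up to 0 puts the base point of the integral at 0 and, with continuity, bounds
  the function on every half-line below \<open>t\<close>. Integrals of causal functions are
  therefore finite, and \<open>enn2real\<close> loses nothing.\<close>

definition causal :: "(real \<Rightarrow> real) \<Rightarrow> bool" where
  "causal h \<longleftrightarrow> continuous_on UNIV h \<and> (\<forall>x. 0 \<le> h x) \<and> (\<forall>x\<le>0. h x = 0)"

lemma causal_measurable: "causal h \<Longrightarrow> h \<in> borel_measurable borel"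
  by (auto simp: causal_def intro: borel_measurable_continuous_onI)

lemma causal_continuous_on: "causal h \<Longrightarrow> continuous_on S h"
  by (auto simp: causal_def intro: continuous_on_subset)

lemma causal_bounded:
  assumes "causal h"
  obtains M where "M \<ge> 0" "\<And>x. x \<le> t \<Longrightarrow> h x \<le> M"
proof -
  have "compact (h ` {0..t})"
    using assms by (intro compact_continuous_image causal_continuous_on) auto
  then obtain M where M: "\<And>x. x \<in> {0..t} \<Longrightarrow> norm (h x) \<le> M"
    by (meson bounded_iff compact_imp_bounded imageI)
  show ?thesis
  proof (rule that[of "max 0 M"])
    fix x assume "x \<le> t"
    then show "h x \<le> max 0 M"
      using M[of x] assms by (cases "x \<ge> 0") (auto simp: causal_def)
  qed auto
qed

lemma rl_nn_le:
  assumes "\<beta> > 0" "M \<ge> 0" "\<And>x. x < t \<Longrightarrow> h x \<le> M" "\<And>x. x \<le> 0 \<Longrightarrow> h x = 0"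
  shows "rl_nn \<beta> (\<lambda>x. ennreal (h x)) t \<le> ennreal (M * rl_kernel (\<beta> + 1) t)"
proof -
  have "ennreal (h x) \<le> ennreal M * indicator {0<..} x" if "x < t" for x
    using assms(3)[OF that] assms(4)[of x] by (cases "x \<le> 0") (auto intro: ennreal_leI)
  then have "rl_nn \<beta> (\<lambda>x. ennreal (h x)) t \<le> rl_nn \<beta> (\<lambda>x. ennreal M * indicator {0<..} x) t"
    by (intro rl_nn_mono)
  also have "\<dots> = ennreal (M * rl_kernel (\<beta> + 1) t)"
    using assms by (simp add: rl_nn_indicator)
  finally show ?thesis .
qed

lemma rl_integral_le:
  assumes "\<beta> > 0" "M \<ge> 0" "\<And>x. x < t \<Longrightarrow> h x \<le> M" "\<And>x. x \<le> 0 \<Longrightarrow> h x = 0"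
  shows "rl_integral \<beta> h t \<le> M * rl_kernel (\<beta> + 1) t"
  unfolding rl_integral_def
  using rl_nn_le[OF assms] assms(1,2) by (intro enn2real_leI) auto

lemma rl_integral_nonneg [simp]: "0 \<le> rl_integral \<beta> h t"
  by (simp add: rl_integral_def)

lemma ennreal_rl_integral:
  assumes "\<beta> > 0" "causal h"
  shows "ennreal (rl_integral \<beta> h t) = rl_nn \<beta> (\<lambda>x. ennreal (h x)) t"
proof -
  obtain M where "M \<ge> 0" "\<And>x. x \<le> t \<Longrightarrow> h x \<le> M"
    using causal_bounded[OF assms(2)] by blast
  then have "rl_nn \<beta> (\<lambda>x. ennreal (h x)) t \<le> ennreal (M * rl_kernel (\<beta> + 1) t)"
    using assms by (intro rl_nn_le) (auto simp: causal_def)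
  then have "rl_nn \<beta> (\<lambda>x. ennreal (h x)) t < top"
    using ennreal_less_top le_less_trans by blast
  then show ?thesis by (simp add: rl_integral_def)
qed

lemma rl_integral_cong:
  "(\<And>x. x < t \<Longrightarrow> h x = h' x) \<Longrightarrow> rl_integral \<beta> h t = rl_integral \<beta> h' t"
  using rl_nn_cong[of t "\<lambda>x. ennreal (h x)" "\<lambda>x. ennreal (h' x)" \<beta>] by (simp add: rl_integral_def)

lemma tendsto_rl_integral:
  assumes "\<beta> > 0" "M \<ge> 0"
    and "\<And>n. causal (h n)" "causal h'"
    and bound: "\<And>n x. x < t \<Longrightarrow> h n x \<le> M"
    and lim: "\<And>x. x < t \<Longrightarrow> (\<lambda>n. h n x) \<longlonglongrightarrow> h' x"
  shows "(\<lambda>n. rl_integral \<beta> (h n) t) \<longlonglongrightarrow> rl_integral \<beta> h' t"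
proof -
  note [measurable] = causal_measurable[OF assms(3)] causal_measurable[OF assms(4)]
  have "ennreal (h n x) \<le> ennreal M * indicator {0<..} x" if "x < t" for n x
    using bound[OF that] assms(3) by (cases "x \<le> 0") (auto intro: ennreal_leI simp: causal_def)
  then have "(\<lambda>n. rl_nn \<beta> (\<lambda>x. ennreal (h n x)) t) \<longlonglongrightarrow> rl_nn \<beta> (\<lambda>x. ennreal (h' x)) t"
    using assms(1,2) by (intro rl_nn_dominated_convergence[where a = 0 and M = M]) (auto intro!: tendsto_ennrealI lim)
  then have "(\<lambda>n. ennreal (rl_integral \<beta> (h n) t)) \<longlonglongrightarrow> ennreal (rl_integral \<beta> h' t)"
    by (simp add: ennreal_rl_integral assms)
  then show ?thesis by (simp add: tendsto_ennreal_iff)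
qed

text \<open>Moving the argument of the integral amounts to translating \<open>h\<close>, so
  continuity follows from dominated convergence for the translates along a convergent
  sequence.\<close>

lemma causal_rl_integral:
  assumes "\<beta> > 0" "causal h"
  shows "causal (rl_integral \<beta> h)"
proof -
  note [measurable] = causal_measurable[OF assms(2)]
  have h_lim: "(\<lambda>n. h (y n)) \<longlonglongrightarrow> h z" if "y \<longlonglongrightarrow> z" for y z
  proof -
    have "isCont h z" using assms(2) by (simp add: causal_def continuous_on_eq_continuous_at)
    then show ?thesis using that by (rule isCont_tendsto_compose)
  qed
  have "(\<lambda>n. rl_integral \<beta> h (s n)) \<longlonglongrightarrow> rl_integral \<beta> h t" if s: "s \<longlonglongrightarrow> t" for s t
  proof -
    have "bounded (range s)"
      using s convergent_imp_bounded by (auto simp: convergent_def)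
    then obtain B where B: "\<And>n. \<bar>s n\<bar> \<le> B"
      unfolding bounded_iff by auto
    obtain M where M: "M \<ge> 0" "\<And>x. x \<le> B \<Longrightarrow> h x \<le> M"
      using causal_bounded[OF assms(2)] by blast
    have shift: "rl_nn \<beta> (\<lambda>x. ennreal (h x)) (s n) = rl_nn \<beta> (\<lambda>x. ennreal (h (x + (s n - t)))) t" for n
      by (simp add: rl_nn_def algebra_simps)
    have "(\<lambda>n. rl_nn \<beta> (\<lambda>x. ennreal (h (x + (s n - t)))) t) \<longlonglongrightarrow> rl_nn \<beta> (\<lambda>x. ennreal (h x)) t"
    \<comment> \<open>The translate by \<open>s n - t\<close> vanishes up to \<open>t - s n\<close>,
      hence up to \<open>t - B\<close>; for \<open>x < t\<close> its argument stays below
      \<open>B\<close>, where \<open>M\<close> bounds \<open>h\<close>.\<close>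
    proof (rule rl_nn_dominated_convergence[where a = "t - B" and M = M])
      show "ennreal (h (x + (s n - t))) \<le> ennreal M * indicator {t - B<..} x" if "x < t" for n x
      proof (cases "x \<le> t - B")
        case True
        with B[of n] have "x + (s n - t) \<le> 0" by linarith
        with True assms(2) show ?thesis by (auto simp: causal_def)
      next
        case False
        with B[of n] that M(2)[of "x + (s n - t)"] show ?thesis by (auto intro: ennreal_leI)
      qed
      show "(\<lambda>n. ennreal (h (x + (s n - t)))) \<longlonglongrightarrow> ennreal (h x)" for x
        by (intro tendsto_ennrealI h_lim) (auto intro!: tendsto_eq_intros s)
    qed (use assms M in auto)
    then have "(\<lambda>n. ennreal (rl_integral \<beta> h (s n))) \<longlonglongrightarrow> ennreal (rl_integral \<beta> h t)"
      by (simp add: ennreal_rl_integral assms shift)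
    then show ?thesis by (simp add: tendsto_ennreal_iff)
  qed
  then have "continuous_on UNIV (rl_integral \<beta> h)"
    unfolding continuous_on_sequentially by (auto simp: comp_def)
  moreover have "rl_integral \<beta> h x = 0" if "x \<le> 0" for x
  proof -
    have "rl_integral \<beta> h x = rl_integral \<beta> (\<lambda>_. 0) x"
      using that assms(2) by (intro rl_integral_cong) (auto simp: causal_def)
    also have "\<dots> = 0" by (simp add: rl_integral_def rl_nn_def)
    finally show ?thesis .
  qed
  ultimately show ?thesis by (simp add: causal_def)
qed

lemma rl_integral_rl_integral:
  assumes "\<beta> > 0" "\<gamma> > 0" "causal h"
  shows "rl_integral \<beta> (rl_integral \<gamma> h) t = rl_integral (\<beta> + \<gamma>) h t"
proof -
  note [measurable] = causal_measurable[OF assms(3)]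
  have "rl_nn \<beta> (\<lambda>x. ennreal (rl_integral \<gamma> h x)) t = rl_nn \<beta> (rl_nn \<gamma> (\<lambda>x. ennreal (h x))) t"
    by (simp only: ennreal_rl_integral[OF assms(2,3)])
  also have "\<dots> = rl_nn (\<beta> + \<gamma>) (\<lambda>x. ennreal (h x)) t"
    by (rule rl_nn_rl_nn) (use assms in auto)
  finally show ?thesis by (simp only: rl_integral_def[of \<beta> "rl_integral \<gamma> h"] rl_integral_def[of "\<beta> + \<gamma>"])
qed

section \<open>Derivatives and increments of the integrals\<close>

lemma rl_integral_one:
  assumes "causal h" "0 \<le> t"
  shows "rl_integral 1 h t = integral {0..t} h"
proof -
  note [measurable] = causal_measurable[OF assms(1)]
  have h: "h integrable_on {0..t}"
    using assms(1) by (intro integrable_continuous_real causal_continuous_on)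
  have "rl_nn 1 (\<lambda>x. ennreal (h x)) t = (\<integral>\<^sup>+s. ennreal (h s) * indicator {0..t} s \<partial>lborel)"
    using assms(1) by (intro rl_nn_one) (auto simp: causal_def)
  also have "\<dots> = ennreal (integral {0..t} h)"
    using assms(1) h by (intro nn_integral_has_integral_lebesgue') (auto simp: causal_def)
  finally show ?thesis
    using assms(1) by (simp add: rl_integral_def causal_def integral_nonneg h)
qed

lemma rl_integral_Suc:
  assumes "\<beta> > 0" "causal h" "0 \<le> t"
  shows "rl_integral (\<beta> + 1) h t = integral {0..t} (rl_integral \<beta> h)"
  using rl_integral_rl_integral[of 1 \<beta> h t] rl_integral_one[OF causal_rl_integral[OF assms(1,2)] assms(3)] assms(1,2)
  by (simp only: add.commute[of \<beta> 1] zero_less_one)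

lemma rl_integral_has_vector_derivative:
  assumes "\<beta> > 0" "causal h" "t \<in> {0..1}"
  shows "(rl_integral (\<beta> + 1) h has_vector_derivative rl_integral \<beta> h t) (at t within {0..1})"
proof -
  have "continuous_on {0..1} (rl_integral \<beta> h)"
    by (intro causal_continuous_on causal_rl_integral assms)
  from integral_has_vector_derivative[OF this assms(3)] show ?thesis
    by (rule has_vector_derivative_transform[OF assms(3), rotated]) (simp add: rl_integral_Suc assms)
qed

lemma rl_integral_diff:
  assumes "\<beta> > 0" "causal h" "0 \<le> s" "s \<le> t"
  shows "rl_integral (\<beta> + 1) h t - rl_integral (\<beta> + 1) h s = integral {s..t} (rl_integral \<beta> h)"
proof -
  have "continuous_on {0..t} (rl_integral \<beta> h)"
    by (intro causal_continuous_on causal_rl_integral assms)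
  then have "integral {0..s} (rl_integral \<beta> h) + integral {s..t} (rl_integral \<beta> h) = integral {0..t} (rl_integral \<beta> h)"
    using assms by (intro Henstock_Kurzweil_Integration.integral_combine integrable_continuous_real) auto
  then show ?thesis using assms by (simp add: rl_integral_Suc)
qed

text \<open>The derivative is the integral of order \<beta>, which is at most
  \<open>M * x powr \<beta> / Gamma (\<beta> + 1)\<close>, and \<open>x powr \<beta>\<close> is at
  most 1 on the unit interval.\<close>

lemma rl_integral_lipschitz:
  assumes "\<beta> > 0" "causal h" "M \<ge> 0" "\<And>x. h x \<le> M" "s \<in> {0..1}" "t \<in> {0..1}"
  shows "\<bar>rl_integral (\<beta> + 1) h t - rl_integral (\<beta> + 1) h s\<bar> \<le> M / Gamma (\<beta> + 1) * \<bar>t - s\<bar>"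
proof -
  have "norm (rl_integral (\<beta> + 1) h t - rl_integral (\<beta> + 1) h s) \<le> M / Gamma (\<beta> + 1) * norm (t - s)"
  proof (rule differentiable_bound[where S = "{0..1}" and f' = "\<lambda>x y. y *\<^sub>R rl_integral \<beta> h x"])
    fix x :: real assume x: "x \<in> {0..1}"
    show "(rl_integral (\<beta> + 1) h has_derivative (\<lambda>y. y *\<^sub>R rl_integral \<beta> h x)) (at x within {0..1})"
      using rl_integral_has_vector_derivative[OF assms(1,2) x] by (simp add: has_vector_derivative_def)
    have "rl_integral \<beta> h x \<le> M * rl_kernel (\<beta> + 1) x"
      using assms by (intro rl_integral_le) (auto simp: causal_def)
    also have "\<dots> \<le> M * (1 / Gamma (\<beta> + 1))"
      using assms x Gamma_real_pos[of "\<beta> + 1"]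
      by (intro mult_left_mono) (auto simp: rl_kernel_def divide_right_mono powr_le1)
    finally have "\<bar>rl_integral \<beta> h x\<bar> \<le> M / Gamma (\<beta> + 1)" by simp
    then show "onorm (\<lambda>y. y *\<^sub>R rl_integral \<beta> h x) \<le> M / Gamma (\<beta> + 1)"
      by (intro onorm_le) (simp add: abs_mult mult.commute[of _ "\<bar>_\<bar>"] mult_left_mono del: times_divide_eq_left times_divide_eq_right)
  qed (use assms in auto)
  then show ?thesis by simp
qed

text \<open>In convolution form the kernel does not depend on the end point, so monotonicity of
  \<open>h\<close> passes through the integral pointwise.\<close>

lemma rl_integral_mono:
  assumes "\<beta> > 0" "causal h" "mono h" "s \<le> t"
  shows "rl_integral \<beta> h s \<le> rl_integral \<beta> h t"
proof -
  have "rl_nn \<beta> (\<lambda>x. ennreal (h x)) s \<le> rl_nn \<beta> (\<lambda>x. ennreal (h x)) t"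
    unfolding rl_nn_def
    using monoD[OF assms(3)] assms(4) by (intro nn_integral_mono mult_left_mono ennreal_leI) auto
  then have "ennreal (rl_integral \<beta> h s) \<le> ennreal (rl_integral \<beta> h t)"
    by (simp add: ennreal_rl_integral assms)
  then show ?thesis by simp
qed

text \<open>A vanishing integral forces the nonnegative integrand to vanish almost everywhere, but
  by continuity of \<open>h\<close> at \<open>t\<close> it is positive on a whole interval to the
  right of \<open>x = 0\<close>.\<close>

lemma rl_integral_pos:
  assumes "\<beta> > 0" "causal h" "h t > 0"
  shows "rl_integral \<beta> h t > 0"
proof (rule ccontr)
  note [measurable] = causal_measurable[OF assms(2)]
  assume "\<not> rl_integral \<beta> h t > 0"
  then have "rl_integral \<beta> h t = 0"
    using rl_integral_nonneg[of \<beta> h t] by linarith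
  then have "rl_nn \<beta> (\<lambda>x. ennreal (h x)) t = 0"
    using ennreal_rl_integral[OF assms(1,2)] by (metis ennreal_0)
  then have ae: "AE x in lborel. ennreal (rl_kernel \<beta> x) * ennreal (h (t - x)) = 0"
    unfolding rl_nn_def by (subst (asm) nn_integral_0_iff_AE) auto
  have "isCont h t" using assms(2) by (simp add: causal_def continuous_on_eq_continuous_at)
  then obtain d where d: "d > 0" "\<And>y. dist y t < d \<Longrightarrow> dist (h y) (h t) < h t"
    using assms(3) by (force simp: continuous_at_eps_delta)
  have "h (t - x) > 0" if "x \<in> {0<..<d}" for x
    using d(2)[of "t - x"] that by (auto simp: dist_real_def)
  moreover have "rl_kernel \<beta> x > 0" if "x \<in> {0<..<d}" for x
    using that Gamma_real_pos[OF assms(1)] by (simp add: rl_kernel_def)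
  ultimately have "ennreal (rl_kernel \<beta> x) * ennreal (h (t - x)) \<noteq> 0" if "x \<in> {0<..<d}" for x
    using that by (metis ennreal_eq_0_iff mult_eq_0_iff not_le)
  with ae have "AE x in lborel. x \<notin> {0<..<d}"
    by (auto elim!: eventually_mono)
  then have "emeasure lborel {0<..<d} = 0"
    by (subst AE_iff_null_sets[THEN iffD2, THEN null_setsD1]) auto
  with d show False by simp
qed

section \<open>Fixed points of Volterra operators\<close>

text \<open>The fixed point problem \<open>u t = G u - T u t\<close> in abstract form. Continuity of
  \<open>T\<close> and \<open>G\<close> is asked along pointwise convergent sequences, the form that
  dominated convergence delivers.\<close>

locale volterra_operator =
  fixes T :: "(real \<Rightarrow> real) \<Rightarrow> real \<Rightarrow> real" and G :: "(real \<Rightarrow> real) \<Rightarrow> real" and K \<nu> :: real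
  assumes T_zero: "\<And>u. continuous_on {0..1} u \<Longrightarrow> T u 0 = 0"
    and T_causal: "\<And>u v t. \<lbrakk>continuous_on {0..1} u; continuous_on {0..1} v; t \<in> {0..1};
                     \<And>s. s \<in> {0..t} \<Longrightarrow> u s = v s\<rbrakk> \<Longrightarrow> T u t = T v t"
    and T_lipschitz: "\<And>u s t. \<lbrakk>continuous_on {0..1} u; s \<in> {0..1}; t \<in> {0..1}\<rbrakk>
                     \<Longrightarrow> \<bar>T u t - T u s\<bar> \<le> K * \<bar>t - s\<bar>"
    and T_tendsto: "\<And>v u t. \<lbrakk>\<And>n. continuous_on {0..1} (v n); continuous_on {0..1} u;
                     \<And>t. t \<in> {0..1} \<Longrightarrow> (\<lambda>n. v n t) \<longlonglongrightarrow> u t; t \<in> {0..1}\<rbrakk>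
                     \<Longrightarrow> (\<lambda>n. T (v n) t) \<longlonglongrightarrow> T u t"
    and G_tendsto: "\<And>v u. \<lbrakk>\<And>n. continuous_on {0..1} (v n); continuous_on {0..1} u;
                     \<And>t. t \<in> {0..1} \<Longrightarrow> (\<lambda>n. v n t) \<longlonglongrightarrow> u t\<rbrakk>
                     \<Longrightarrow> (\<lambda>n. G (v n)) \<longlonglongrightarrow> G u"
    and G_range: "\<And>u. continuous_on {0..1} u \<Longrightarrow> G u \<in> {0..\<nu>}"
    and K_nonneg: "K \<ge> 0"
begin

text \<open>Because \<open>T u 0 = 0\<close>, the truncation \<open>max 0\<close> makes the step
  return the constant \<open>c\<close> on \<open>[0, d]\<close>, where the method of steps
  starts.\<close>

definition delay_step :: "real \<Rightarrow> real \<Rightarrow> (real \<Rightarrow> real) \<Rightarrow> real \<Rightarrow> real" where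
  "delay_step d c u t = c - T u (max 0 (t - d))"

definition delay_iter :: "real \<Rightarrow> real \<Rightarrow> nat \<Rightarrow> real \<Rightarrow> real" where
  "delay_iter d c m = (delay_step d c ^^ m) (\<lambda>_. c)"

lemma delay_step_lipschitz:
  assumes "d \<ge> 0" "continuous_on {0..1} u" "s \<in> {0..1}" "t \<in> {0..1}"
  shows "\<bar>delay_step d c u t - delay_step d c u s\<bar> \<le> K * \<bar>t - s\<bar>"
proof -
  have "\<bar>T u (max 0 (t - d)) - T u (max 0 (s - d))\<bar> \<le> K * \<bar>max 0 (t - d) - max 0 (s - d)\<bar>"
    using assms by (intro T_lipschitz) auto
  also have "\<dots> \<le> K * \<bar>t - s\<bar>"
    using K_nonneg by (intro mult_left_mono) auto
  finally show ?thesis by (simp add: delay_step_def abs_minus_commute)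
qed

lemma lipschitz_continuous:
  fixes u :: "real \<Rightarrow> real"
  assumes "\<And>s t. \<lbrakk>s \<in> S; t \<in> S\<rbrakk> \<Longrightarrow> \<bar>u t - u s\<bar> \<le> K * \<bar>t - s\<bar>"
  shows "continuous_on S u"
  by (rule lipschitz_on_continuous_on[of K], rule lipschitz_onI)
     (use assms K_nonneg in \<open>auto simp: dist_real_def\<close>)

lemma continuous_delay_step:
  "d \<ge> 0 \<Longrightarrow> continuous_on {0..1} u \<Longrightarrow> continuous_on {0..1} (delay_step d c u)"
  by (rule lipschitz_continuous) (rule delay_step_lipschitz)

lemma delay_iter_0: "delay_iter d c 0 = (\<lambda>_. c)"
  and delay_iter_Suc: "delay_iter d c (Suc m) = delay_step d c (delay_iter d c m)"
  by (simp_all add: delay_iter_def)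

lemma continuous_delay_iter:
  "d \<ge> 0 \<Longrightarrow> continuous_on {0..1} (delay_iter d c m)"
  by (induction m) (simp_all add: delay_iter_0 delay_iter_Suc continuous_delay_step)

text \<open>Method of steps: the \<open>m\<close>-th iterate already solves the delayed equation on \<open>[0, m d]\<close>.\<close>

lemma delay_iter_stable:
  assumes "d \<ge> 0" "t \<in> {0..1}" "t \<le> real m * d"
  shows "delay_iter d c (Suc m) t = delay_iter d c m t"
  using assms(2,3)
proof (induction m arbitrary: t)
  case 0
  then show ?case
    using assms(1) by (simp add: delay_iter_0 delay_iter_Suc delay_step_def T_zero)
next
  case (Suc m)
  \<comment> \<open>At time \<open>t - d\<close> the operator sees the iterates only up to that
    time, where the induction hypothesis identifies them.\<close>
  have "T (delay_iter d c (Suc m)) (max 0 (t - d)) = T (delay_iter d c m) (max 0 (t - d))"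
  proof (rule T_causal)
    fix s assume s: "s \<in> {0..max 0 (t - d)}"
    show "delay_iter d c (Suc m) s = delay_iter d c m s"
    proof (rule Suc.IH)
      show "s \<in> {0..1}" using s Suc.prems assms(1) by auto
      have "t - d \<le> real m * d" using Suc.prems by (simp add: algebra_simps)
      moreover have "0 \<le> real m * d" using assms(1) by simp
      ultimately show "s \<le> real m * d" using s by auto
    qed
  qed (use Suc.prems assms(1) in \<open>auto intro: continuous_delay_iter\<close>)
  then show ?case by (simp add: delay_iter_Suc[of d c "Suc m"] delay_iter_Suc[of d c m] delay_step_def)
qed

lemma delay_iter_tendsto:
  assumes "d \<ge> 0" "c \<longlonglongrightarrow> c0" "t \<in> {0..1}"
  shows "(\<lambda>n. delay_iter d (c n) m t) \<longlonglongrightarrow> delay_iter d c0 m t"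
  using assms(3)
proof (induction m arbitrary: t)
  case 0
  then show ?case using assms(2) by (simp add: delay_iter_0)
next
  case (Suc m)
  then show ?case
    unfolding delay_iter_Suc delay_step_def using assms(1)
    by (intro tendsto_diff assms(2) T_tendsto continuous_delay_iter) auto
qed

lemma delayed_solution:
  assumes "\<nu> \<ge> 0" "n > 0"
  obtains u where "continuous_on {0..1} u" "\<And>t. t \<in> {0..1} \<Longrightarrow> u t = G u - T u (max 0 (t - 1 / real n))"
    "\<And>s t. \<lbrakk>s \<in> {0..1}; t \<in> {0..1}\<rbrakk> \<Longrightarrow> \<bar>u t - u s\<bar> \<le> K * \<bar>t - s\<bar>"
proof -
  define d where "d = 1 / real n"
  have d: "d \<ge> 0" "real n * d = 1" using assms by (auto simp: d_def)
  \<comment> \<open>As \<open>real n * d = 1\<close>, the \<open>n\<close>-th iterate solves the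
    delayed equation on all of \<open>[0, 1]\<close>.\<close>
  define V where "V c = delay_iter d c n" for c
  have "continuous_on {0..\<nu>} (\<lambda>c. c - G (V c))"
    unfolding continuous_on_sequentially comp_def V_def
    by (auto intro!: tendsto_diff G_tendsto continuous_delay_iter delay_iter_tendsto d)
  moreover have "G (V c) \<in> {0..\<nu>}" for c
    unfolding V_def by (intro G_range continuous_delay_iter d)
  ultimately have "\<exists>c\<ge>0. c \<le> \<nu> \<and> c - G (V c) = 0"
    using assms(1) by (intro IVT') (auto simp: algebra_simps)
  then obtain c where c: "G (V c) = c" by (metis right_minus_eq)
  have V: "V c t = delay_step d c (V c) t" if "t \<in> {0..1}" for t
    unfolding V_def using delay_iter_stable[of d t n c] d that by (simp add: delay_iter_Suc)
  show ?thesis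
  proof
    show "continuous_on {0..1} (V c)" unfolding V_def by (intro continuous_delay_iter d)
    then show "\<bar>V c t - V c s\<bar> \<le> K * \<bar>t - s\<bar>" if "s \<in> {0..1}" "t \<in> {0..1}" for s t
      using delay_step_lipschitz[OF d(1) _ that, of "V c" c] V that by simp
    show "V c t = G (V c) - T (V c) (max 0 (t - 1 / real n))" if "t \<in> {0..1}" for t
      using V[OF that] by (simp add: c delay_step_def d_def)
  qed
qed

lemma fixed_point:
  assumes "\<nu> \<ge> 0"
  obtains u where "continuous_on {0..1} u" "\<And>t. t \<in> {0..1} \<Longrightarrow> u t = G u - T u t"
proof -
  have "\<exists>u. continuous_on {0..1} u \<and> (\<forall>t\<in>{0..1}. u t = G u - T u (max 0 (t - 1 / real (Suc n))))
      \<and> (\<forall>s\<in>{0..1}. \<forall>t\<in>{0..1}. \<bar>u t - u s\<bar> \<le> K * \<bar>t - s\<bar>)" for n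
    using delayed_solution[OF assms, of "Suc n"] by (metis zero_less_Suc)
  then obtain v where v: "\<And>n. continuous_on {0..1} (v n)"
    "\<And>n t. t \<in> {0..1} \<Longrightarrow> v n t = G (v n) - T (v n) (max 0 (t - 1 / real (Suc n)))"
    "\<And>n s t. \<lbrakk>s \<in> {0..1}; t \<in> {0..1}\<rbrakk> \<Longrightarrow> \<bar>v n t - v n s\<bar> \<le> K * \<bar>t - s\<bar>"
    by metis
  have v0: "v n 0 = G (v n)" for n
    using v(2)[of 0 n] by (simp add: T_zero v(1))
  \<comment> \<open>All delayed solutions start in \<open>[0, \<nu>]\<close> and share the Lipschitz
    constant \<open>K\<close>, whatever the delay; this yields the uniform bound and the
    equicontinuity for Arzela--Ascoli.\<close>
  have bound: "norm (v n t) \<le> \<nu> + K" if "t \<in> {0..1}" for n t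
  proof -
    have "\<bar>v n t - v n 0\<bar> \<le> K * \<bar>t - 0\<bar>" using that by (intro v) auto
    also have "\<dots> \<le> K * 1" using that K_nonneg by (intro mult_left_mono) auto
    finally show ?thesis using G_range[OF v(1)[of n]] v0[of n] by auto
  qed
  have "\<exists>\<delta>>0. \<forall>n y. y \<in> {0..1} \<and> norm (x - y) < \<delta> \<longrightarrow> norm (v n x - v n y) < e"
    if "x \<in> {0..1}" "e > 0" for x e
  \<comment> \<open>The denominator \<open>K + 1\<close> also covers \<open>K = 0\<close>.\<close>
  proof (intro exI[of _ "e / (K + 1)"] conjI allI impI)
    show "e / (K + 1) > 0" using that K_nonneg by simp
    fix n y assume y: "y \<in> {0..1} \<and> norm (x - y) < e / (K + 1)"
    then have "\<bar>v n x - v n y\<bar> \<le> K * \<bar>x - y\<bar>" using that by (intro v) auto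
    also have "\<dots> \<le> (K + 1) * \<bar>x - y\<bar>" by (intro mult_right_mono) auto
    also have "\<dots> < e" using y K_nonneg by (simp add: field_simps)
    finally show "norm (v n x - v n y) < e" by simp
  qed
  from Arzela_Ascoli[OF compact_Icc bound this]
  obtain u k where u: "continuous_on {0..1} u" and k: "strict_mono (k :: nat \<Rightarrow> nat)"
    and unif: "\<And>e. 0 < e \<Longrightarrow> \<exists>N. \<forall>n x. n \<ge> N \<and> x \<in> {0..1} \<longrightarrow> norm (v (k n) x - u x) < e"
    by metis
  have lim: "(\<lambda>n. v (k n) t) \<longlonglongrightarrow> u t" if "t \<in> {0..1}" for t
    unfolding LIMSEQ_iff using unif that by blast
  have Glim: "(\<lambda>n. G (v (k n))) \<longlonglongrightarrow> G u"
    by (intro G_tendsto v u lim)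
  have "u t = G u - T u t" if t: "t \<in> {0..1}" for t
  proof -
    \<comment> \<open>The Lipschitz bound is uniform in \<open>u\<close>, so the effect of the delay
      disappears along with the delay.\<close>
    have dist: "\<bar>T (v (k n)) (max 0 (t - 1 / real (Suc (k n)))) - T (v (k n)) t\<bar> \<le> K * (1 / real (Suc (k n)))" for n
    proof -
      have "\<bar>T (v (k n)) (max 0 (t - 1 / real (Suc (k n)))) - T (v (k n)) t\<bar>
          \<le> K * \<bar>max 0 (t - 1 / real (Suc (k n))) - t\<bar>"
        using t by (intro T_lipschitz v) (auto intro: order_trans[of _ t])
      also have "\<dots> \<le> K * (1 / real (Suc (k n)))"
        using t K_nonneg by (intro mult_left_mono) (auto simp: max_def)
      finally show ?thesis .
    qed
    have "(\<lambda>n. 1 / real (Suc (k n))) \<longlonglongrightarrow> 0"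
      using LIMSEQ_subseq_LIMSEQ[OF LIMSEQ_inverse_real_of_nat k] by (simp add: comp_def inverse_eq_divide)
    then have "(\<lambda>n. K * (1 / real (Suc (k n)))) \<longlonglongrightarrow> 0"
      by (rule tendsto_mult_right_zero)
    then have "(\<lambda>n. T (v (k n)) (max 0 (t - 1 / real (Suc (k n)))) - T (v (k n)) t) \<longlonglongrightarrow> 0"
      by (rule Lim_null_comparison[rotated]) (use dist in simp)
    from tendsto_add[OF this T_tendsto[OF v(1) u lim t]]
    have "(\<lambda>n. T (v (k n)) (max 0 (t - 1 / real (Suc (k n))))) \<longlonglongrightarrow> T u t" by simp
    from tendsto_diff[OF Glim this] have "(\<lambda>n. v (k n) t) \<longlonglongrightarrow> G u - T u t"
      using v(2)[OF t] by simp
    with lim[OF t] show ?thesis using LIMSEQ_unique by blast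
  qed
  with u show ?thesis by (rule that)
qed

end

section \<open>Indefinite Lebesgue integrals\<close>

text \<open>Lebesgue differentiation for cubes with a fixed lower corner, read in dimension one; it
  controls right-hand averages only.\<close>

lemma right_average_tendsto_AE:
  fixes f :: "real \<Rightarrow> real"
  assumes "\<And>a b. f integrable_on {a..b}"
  obtains N where "negligible N" "\<And>x e. \<lbrakk>x \<notin> N; 0 < e\<rbrakk> \<Longrightarrow>
    \<exists>d>0. \<forall>h. 0 < h \<and> h < d \<longrightarrow> \<bar>integral {x..x + h} f / h - f x\<bar> < e"
proof -
  have "f integrable_on cbox a b" for a b
    using assms by simp
  from integrable_ccontinuous_explicit[OF this]
  obtain N where "negligible N" and N: "\<And>x e. \<lbrakk>x \<notin> N; 0 < e\<rbrakk> \<Longrightarrow>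
      \<exists>d>0. \<forall>h. 0 < h \<and> h < d \<longrightarrow> norm (integral (cbox x (x + h *\<^sub>R One)) f /\<^sub>R h ^ DIM(real) - f x) < e"
    by blast
  show ?thesis
    by (rule that[OF \<open>negligible N\<close>]) (use N in \<open>simp add: divide_inverse mult.commute\<close>)
qed

text \<open>Left-hand averages of a function are right-hand averages of its reflection, so
  \<open>right_average_tendsto_AE\<close> is applied to both, and the second exceptional set is
  reflected back.\<close>

lemma indefinite_integral_has_derivative_AE:
  fixes f :: "real \<Rightarrow> real"
  assumes "f integrable_on {a..b}"
  obtains N where "negligible N"
    "\<And>x. x \<in> {a<..<b} - N \<Longrightarrow> ((\<lambda>t. integral {a..t} f) has_real_derivative f x) (at x)"
proof -
  \<comment> \<open>Extension by 0 makes the function integrable on every interval, as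
    \<open>right_average_tendsto_AE\<close> requires.\<close>
  define F where "F x = (if x \<in> {a..b} then f x else 0)" for x
  have "F integrable_on UNIV"
    using assms unfolding F_def by (simp only: integrable_restrict_UNIV)
  then have F: "F integrable_on {c..d}" for c d
    by (rule integrable_on_subinterval) simp
  have "(\<lambda>x. F (- x)) integrable_on {c..d}" for c d
    using F[of "-d" "-c"] Henstock_Kurzweil_Integration.integrable_reflect_real[where f = F and a = "-d" and b = "-c"] by simp
  then obtain N' where N': "negligible N'" "\<And>x e. \<lbrakk>x \<notin> N'; 0 < e\<rbrakk> \<Longrightarrow>
      \<exists>d>0. \<forall>h. 0 < h \<and> h < d \<longrightarrow> \<bar>integral {x..x + h} (\<lambda>x. F (- x)) / h - F (- x)\<bar> < e"
    using right_average_tendsto_AE by (metis (no_types, lifting))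
  obtain N where N: "negligible N" "\<And>x e. \<lbrakk>x \<notin> N; 0 < e\<rbrakk> \<Longrightarrow>
      \<exists>d>0. \<forall>h. 0 < h \<and> h < d \<longrightarrow> \<bar>integral {x..x + h} F / h - F x\<bar> < e"
    using right_average_tendsto_AE[OF F] by metis
  show ?thesis
  proof
    show "negligible (N \<union> uminus ` N')"
      using N(1) N'(1) by (auto intro!: negligible_Un negligible_differentiable_image_negligible derivative_intros simp: differentiable_on_def)
    fix x assume x: "x \<in> {a<..<b} - (N \<union> uminus ` N')"
    then have nx: "x \<notin> N" "- x \<notin> N'" by force+
    have fF: "integral {c..d} F = integral {c..d} f" if "a \<le> c" "d \<le> b" for c d
      using that by (intro integral_cong) (auto simp: F_def)
    have comb: "integral {a..d} f - integral {a..c} f = integral {c..d} F" if "a \<le> c" "c \<le> d" "d \<le> b" for c d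
      using Henstock_Kurzweil_Integration.integral_combine[of a c d f] that fF[of c d]
        integrable_on_subinterval[OF assms, of a d] by auto
    show "((\<lambda>t. integral {a..t} f) has_real_derivative f x) (at x)"
      unfolding DERIV_def LIM_eq
    proof (intro allI impI)
      fix e :: real assume "e > 0"
      obtain d1 where d1: "d1 > 0" "\<And>h. 0 < h \<Longrightarrow> h < d1 \<Longrightarrow> \<bar>integral {x..x + h} F / h - F x\<bar> < e"
        using N(2)[OF nx(1) \<open>e > 0\<close>] by blast
      obtain d2 where d2: "d2 > 0" "\<And>h. 0 < h \<Longrightarrow> h < d2 \<Longrightarrow> \<bar>integral {-x..-x + h} (\<lambda>x. F (- x)) / h - F x\<bar> < e"
        using N'(2)[OF nx(2) \<open>e > 0\<close>] by auto
      define s where "s = Min {d1, d2, x - a, b - x}"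
      have s: "s > 0" "s \<le> d1" "s \<le> d2" "s \<le> x - a" "s \<le> b - x"
        using d1(1) d2(1) x by (auto simp: s_def)
      have "norm ((integral {a..x + h} f - integral {a..x} f) / h - f x) < e" if h: "h \<noteq> 0" "\<bar>h\<bar> < s" for h
      proof (cases "h > 0")
        case True
        then have "(integral {a..x + h} f - integral {a..x} f) / h = integral {x..x + h} F / h"
          using comb[of x "x + h"] s h x by simp
        then show ?thesis using d1(2)[of h] True h s x by (simp add: F_def)
      next
        case False
        have "(integral {a..x + h} f - integral {a..x} f) / h = integral {x + h..x} F / (- h)"
          using comb[of "x + h" x] s h x False by (simp add: field_simps)
        also have "integral {x + h..x} F = integral {-x..-x + (- h)} (\<lambda>x. F (- x))"
          using Henstock_Kurzweil_Integration.integral_reflect_real[where f = F and a = "x + h" and b = x] by simp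
        finally show ?thesis using d2(2)[of "- h"] False h s x by (simp add: F_def)
      qed
      with s(1) show "\<exists>s>0. \<forall>h. h \<noteq> 0 \<and> norm (h - 0) < s \<longrightarrow>
          norm ((integral {a..x + h} f - integral {a..x} f) / h - f x) < e"
        by auto
    qed
  qed
qed

text \<open>Truncate \<open>v\<close> at a height \<open>n\<close> so large that the excess
  \<open>r\<close> has integral below \<open>\<epsilon> / 2\<close>. Over intervals of small total
  length the truncated part contributes at most \<open>n\<close> times that length.\<close>

lemma abs_continuous_on_integral_bound:
  fixes v F :: "real \<Rightarrow> real"
  assumes v: "v integrable_on {a..b}" "\<And>x. x \<in> {a..b} \<Longrightarrow> 0 \<le> v x"
    and F: "\<And>c d. \<lbrakk>a \<le> c; c \<le> d; d \<le> b\<rbrakk> \<Longrightarrow> \<bar>F d - F c\<bar> \<le> integral {c..d} v"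
  shows "abs_continuous_on a b F"
  unfolding abs_continuous_on_def
proof (intro allI impI)
  fix \<epsilon> :: real assume "\<epsilon> > 0"
  have vabs: "v absolutely_integrable_on {a..b}"
    using v by (intro nonnegative_absolutely_integrable_1)
  have trunc: "(\<lambda>x. min (v x) (real k)) absolutely_integrable_on {a..b}" for k
    by (intro absolutely_integrable_min_1 vabs absolutely_integrable_on_const) auto
  have "(\<lambda>k. integral {a..b} (\<lambda>x. min (v x) (real k))) \<longlonglongrightarrow> integral {a..b} v"
  proof (rule dominated_convergence)
    show "(\<lambda>x. min (v x) (real k)) integrable_on {a..b}" for k
      using trunc by (simp add: absolutely_integrable_on_def)
    show "(\<lambda>k. min (v x) (real k)) \<longlonglongrightarrow> v x" for x
    proof (rule tendsto_eventually)
      obtain n where "v x \<le> real n" using real_arch_simple by blast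
      then show "\<forall>\<^sub>F k in sequentially. min (v x) (real k) = v x"
        by (intro eventually_sequentiallyI[of n]) (auto simp: min_def)
    qed
  qed (use v in auto)
  then have "\<forall>\<^sub>F k in sequentially. integral {a..b} v - \<epsilon> / 2 < integral {a..b} (\<lambda>x. min (v x) (real k))"
    using \<open>\<epsilon> > 0\<close> by (intro order_tendstoD) auto
  then obtain n where n: "integral {a..b} v - \<epsilon> / 2 < integral {a..b} (\<lambda>x. min (v x) (real n))"
    by (auto simp: eventually_sequentially)
  define r where "r x = v x - min (v x) (real n)" for x
  have tr: "(\<lambda>x. min (v x) (real n)) integrable_on {a..b}"
    using trunc by (simp add: absolutely_integrable_on_def)
  have r: "r integrable_on {a..b}" "\<And>x. 0 \<le> r x" "integral {a..b} r < \<epsilon> / 2"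
    unfolding r_def using v tr n by (auto intro!: integrable_diff simp: Henstock_Kurzweil_Integration.integral_diff)
  show "\<exists>\<delta>>0. \<forall>\<D> T. \<D> division_of T \<and> T \<subseteq> {a..b} \<and> (\<Sum>k\<in>\<D>. Sup k - Inf k) < \<delta>
        \<longrightarrow> (\<Sum>k\<in>\<D>. \<bar>F (Sup k) - F (Inf k)\<bar>) < \<epsilon>"
  \<comment> \<open>Then \<open>n\<close> times the total length is at most
    \<open>\<epsilon> / 2\<close>; the summand 1 covers \<open>n = 0\<close>.\<close>
  proof (intro exI[of _ "\<epsilon> / (2 * (real n + 1))"] conjI allI impI)
    show "0 < \<epsilon> / (2 * (real n + 1))" using \<open>\<epsilon> > 0\<close> by simp
    fix \<D> T assume "\<D> division_of T \<and> T \<subseteq> {a..b} \<and> (\<Sum>k\<in>\<D>. Sup k - Inf k) < \<epsilon> / (2 * (real n + 1))"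
    then have D: "\<D> division_of T" and T: "T \<subseteq> {a..b}"
      and small: "(\<Sum>k\<in>\<D>. Sup k - Inf k) < \<epsilon> / (2 * (real n + 1))" by auto
    have rT: "r integrable_on T"
      by (rule integrable_on_subdivision[OF D r(1) T])
    have bound: "\<bar>F (Sup k) - F (Inf k)\<bar> \<le> integral k r + real n * (Sup k - Inf k)" if k: "k \<in> \<D>" for k
    proof -
      obtain c d where cd: "k = {c..d}" using division_ofD(4)[OF D k] by auto
      have "c \<le> d" using division_ofD(3)[OF D k] cd by auto
      have sub: "k \<subseteq> {a..b}" using division_ofD(2)[OF D k] T by blast
      then have ac: "a \<le> c" "d \<le> b" using cd \<open>c \<le> d\<close> by auto
      have v_le: "v x \<le> r x + real n" for x by (simp add: r_def)
      have "\<bar>F d - F c\<bar> \<le> integral {c..d} v" using F ac \<open>c \<le> d\<close> by simp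
      also have "\<dots> \<le> integral {c..d} (\<lambda>x. r x + real n)"
        using integrable_on_subinterval[OF v(1) sub[unfolded cd]] integrable_on_subinterval[OF r(1) sub[unfolded cd]]
        by (intro integral_le integrable_add integrable_const_ivl v_le)
      also have "\<dots> = integral {c..d} r + real n * (d - c)"
        using sub cd \<open>c \<le> d\<close> integrable_on_subinterval[OF r(1)]
        by (subst Henstock_Kurzweil_Integration.integral_add) auto
      finally show ?thesis using cd \<open>c \<le> d\<close> by simp
    qed
    have "(\<Sum>k\<in>\<D>. \<bar>F (Sup k) - F (Inf k)\<bar>) \<le> (\<Sum>k\<in>\<D>. integral k r + real n * (Sup k - Inf k))"
      by (intro sum_mono bound)
    also have "\<dots> = integral T r + real n * (\<Sum>k\<in>\<D>. Sup k - Inf k)"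
      by (simp add: sum.distrib sum_distrib_left integral_combine_division_topdown[OF rT D])
    also have "integral T r \<le> integral {a..b} r"
      by (intro integral_subset_le T rT r) (use r in auto)
    also have "real n * (\<Sum>k\<in>\<D>. Sup k - Inf k) \<le> real n * (\<epsilon> / (2 * (real n + 1)))"
      using small by (intro mult_left_mono) auto
    also have "\<dots> \<le> \<epsilon> / 2" using \<open>\<epsilon> > 0\<close> by (simp add: field_simps)
    finally show "(\<Sum>k\<in>\<D>. \<bar>F (Sup k) - F (Inf k)\<bar>) < \<epsilon>" using r(3) by linarith
  qed
qed

section \<open>Caputo derivatives of fractional potentials\<close>

lemma nderiv_0 [simp]: "nderiv 0 g = g"
  by (simp add: nderiv_def)

lemma nderiv_Suc: "nderiv (Suc k) g t = vector_derivative (nderiv k g) (at t within {0..1})"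
  by (simp add: nderiv_def)

text \<open>A derivative within \<open>[0, 1]\<close> depends only on the values there and is
  unique, so \<open>nderiv\<close> can be computed from a formula valid on that interval
  alone.\<close>

lemma nderiv_has_vector_derivative:
  assumes "\<And>s. s \<in> {0..1} \<Longrightarrow> nderiv k g s = f s"
    and "(f has_vector_derivative d) (at t within {0..1})" "t \<in> {0..1}"
  shows "(nderiv k g has_vector_derivative d) (at t within {0..1})" and "nderiv (Suc k) g t = d"
proof -
  show *: "(nderiv k g has_vector_derivative d) (at t within {0..1})"
    by (rule has_vector_derivative_transform[OF assms(3) assms(1) assms(2)])
  show "nderiv (Suc k) g t = d"
    unfolding nderiv_Suc using vector_derivative_within_cbox[of 0 1 t "nderiv k g" d] * assms(3) by simp
qed

text \<open>A finite integral makes \<open>W\<close> finite almost everywhere on the interval, so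
  \<open>enn2real\<close> alters it only on a null set.\<close>

lemma nn_integral_has_integral_enn2real:
  fixes W :: "real \<Rightarrow> ennreal"
  assumes [measurable]: "W \<in> borel_measurable borel"
    and W: "(\<integral>\<^sup>+s. W s * indicator {a..b} s \<partial>lborel) = ennreal I" and "I \<ge> 0"
  shows "((\<lambda>s. enn2real (W s)) has_integral I) {a..b}"
proof -
  define f where "f s = (if s \<in> {a..b} then enn2real (W s) else 0)" for s
  have "AE s in lborel. W s * indicator {a..b} s \<noteq> \<infinity>"
  proof (rule nn_integral_PInf_AE)
    show "(\<lambda>s. W s * indicator {a..b} s) \<in> borel_measurable lborel" by measurable
  qed (simp add: W)
  then have "(\<integral>\<^sup>+s. ennreal (f s) \<partial>lborel) = (\<integral>\<^sup>+s. W s * indicator {a..b} s \<partial>lborel)"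
    by (intro nn_integral_cong_AE) (auto elim!: eventually_mono simp: f_def less_top)
  then have "(f has_integral I) UNIV"
    unfolding W using \<open>I \<ge> 0\<close>
    by (intro nn_integral_has_integral) (auto simp: f_def[abs_def])
  then show ?thesis unfolding f_def by (simp only: has_integral_restrict_UNIV)
qed

text \<open>The relation between \<open>h\<close> and its density \<open>g\<close> is stated in
  \<open>ennreal\<close>, because \<open>g\<close> may be unbounded, and only up to time 1, beyond
  which the intended \<open>h\<close> is constant.\<close>

locale caputo_potential =
  fixes \<alpha> c :: real and h g :: "real \<Rightarrow> real"
  assumes \<alpha>: "2 < \<alpha>" "\<alpha> \<le> 3" and h: "causal h"
    and g: "g \<in> borel_measurable borel" "\<And>x. x \<le> 0 \<Longrightarrow> g x = 0"
    and h_eq: "\<And>t. t \<le> 1 \<Longrightarrow> ennreal (h t) = rl_nn 1 (\<lambda>x. ennreal (g x)) t"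
begin

section \<open>Derivatives of the potential up to order three\<close>

definition u :: "real \<Rightarrow> real" where
  "u t = c - rl_integral \<alpha> h t"

lemma nderiv_u_1:
  assumes "t \<in> {0..1}"
  shows "(u has_vector_derivative - rl_integral (\<alpha> - 1) h t) (at t within {0..1})"
    and "nderiv 1 u t = - rl_integral (\<alpha> - 1) h t"
proof -
  have "(u has_vector_derivative 0 - rl_integral (\<alpha> - 1) h t) (at t within {0..1})"
    unfolding u_def[abs_def] using rl_integral_has_vector_derivative[of "\<alpha> - 1" h t] \<alpha> h assms
    by (intro has_vector_derivative_diff has_vector_derivative_const) auto
  then show *: "(u has_vector_derivative - rl_integral (\<alpha> - 1) h t) (at t within {0..1})" by simp
  show "nderiv 1 u t = - rl_integral (\<alpha> - 1) h t"
    using nderiv_has_vector_derivative(2)[of 0 u u, OF _ * assms] by simp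
qed

lemma nderiv_u_2:
  assumes "t \<in> {0..1}"
  shows "(nderiv 1 u has_vector_derivative - rl_integral (\<alpha> - 2) h t) (at t within {0..1})"
    and "nderiv 2 u t = - rl_integral (\<alpha> - 2) h t"
proof -
  have "((\<lambda>t. - rl_integral (\<alpha> - 1) h t) has_vector_derivative - rl_integral (\<alpha> - 2) h t) (at t within {0..1})"
    using rl_integral_has_vector_derivative[of "\<alpha> - 2" h t] \<alpha> h assms
    by (intro has_vector_derivative_minus) auto
  from nderiv_has_vector_derivative[of 1 u, OF nderiv_u_1(2) this assms]
  show "(nderiv 1 u has_vector_derivative - rl_integral (\<alpha> - 2) h t) (at t within {0..1})"
    "nderiv 2 u t = - rl_integral (\<alpha> - 2) h t"
    by (simp_all add: numeral_2_eq_2)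
qed

text \<open>For order 3 the second derivative is minus the ordinary primitive of the continuous
  \<open>h\<close>, so the third exists at every point, end points included.\<close>

lemma nderiv_u_3_order_3:
  assumes "\<alpha> = 3" "t \<in> {0..1}"
  shows "(nderiv 2 u has_vector_derivative - h t) (at t within {0..1})"
    and "nderiv 3 u t = - h t"
proof -
  have "((\<lambda>t. integral {0..t} h) has_vector_derivative h t) (at t within {0..1})"
    using assms(2) by (intro integral_has_vector_derivative causal_continuous_on h)
  from has_vector_derivative_minus[OF this]
  have "((\<lambda>t. - integral {0..t} h) has_vector_derivative - h t) (at t within {0..1})" .
  moreover have "\<alpha> - 2 = 1" using assms(1) by simp
  then have "nderiv 2 u s = - integral {0..s} h" if "s \<in> {0..1}" for s
    using nderiv_u_2(2)[OF that] rl_integral_one[OF h, of s] that by simp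
  ultimately show "(nderiv 2 u has_vector_derivative - h t) (at t within {0..1})"
    "nderiv 3 u t = - h t"
    using nderiv_has_vector_derivative[of 2 u, OF _ _ assms(2)] by (simp_all add: numeral_3_eq_3)
qed

text \<open>Almost everywhere minus the third derivative of \<open>u\<close>, see
  \<open>nderiv_u_3\<close>. Where the integral of \<open>g\<close> is infinite,
  \<open>enn2real\<close> puts 0.\<close>

definition v :: "real \<Rightarrow> real" where
  "v s = enn2real (rl_nn (\<alpha> - 2) (\<lambda>x. ennreal (g x)) s)"

lemma v_nonneg [simp]: "0 \<le> v s"
  by (simp add: v_def)

lemma rl_nn_eq_0: "s \<le> 0 \<Longrightarrow> rl_nn \<beta> (\<lambda>x. ennreal (g x)) s = 0"
  using rl_nn_cong[of s "\<lambda>x. ennreal (g x)" "\<lambda>_. 0"] g(2) by (simp add: rl_nn_def)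

text \<open>The semigroup law lets the integrals of orders \<open>\<alpha> - 2\<close> and 1 of
  \<open>g\<close> change places: one order gives the integral of \<open>h\<close>, the other the
  primitive of \<open>v\<close>.\<close>

lemma has_integral_v:
  assumes "t \<in> {0..1}"
  shows "(v has_integral rl_integral (\<alpha> - 2) h t) {0..t}"
  unfolding v_def[abs_def]
proof (rule nn_integral_has_integral_enn2real)
  note [measurable] = g(1)
  let ?G = "\<lambda>x. ennreal (g x)"
  show "rl_nn (\<alpha> - 2) ?G \<in> borel_measurable borel" by measurable
  have "ennreal (rl_integral (\<alpha> - 2) h t) = rl_nn (\<alpha> - 2) (\<lambda>x. ennreal (h x)) t"
    using \<alpha> h by (simp add: ennreal_rl_integral)
  also have "\<dots> = rl_nn (\<alpha> - 2) (rl_nn 1 ?G) t"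
    using assms by (intro rl_nn_cong h_eq) auto
  also have "\<dots> = rl_nn 1 (rl_nn (\<alpha> - 2) ?G) t"
    using \<alpha> by (simp add: rl_nn_rl_nn add.commute)
  also have "\<dots> = (\<integral>\<^sup>+s. rl_nn (\<alpha> - 2) ?G s * indicator {0..t} s \<partial>lborel)"
    by (rule rl_nn_one) (auto simp: rl_nn_eq_0)
  finally show "(\<integral>\<^sup>+s. rl_nn (\<alpha> - 2) ?G s * indicator {0..t} s \<partial>lborel) = ennreal (rl_integral (\<alpha> - 2) h t)" ..
qed simp

text \<open>Up to the factor \<open>Gamma (3 - \<alpha>)\<close> this is the Caputo integral of
  \<open>- u\<close>; the orders \<open>3 - \<alpha>\<close> and \<open>\<alpha> - 2\<close> add up
  to 1.\<close>

lemma has_integral_kernel_v: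
  assumes "\<alpha> < 3" "t \<in> {0..1}"
  shows "((\<lambda>s. rl_kernel (3 - \<alpha>) (t - s) * v s) has_integral h t) {0..t}"
proof -
  note [measurable] = g(1)
  let ?G = "\<lambda>x. ennreal (g x)"
  have "ennreal (h t) = rl_nn (3 - \<alpha>) (rl_nn (\<alpha> - 2) ?G) t"
    using \<alpha> assms by (simp add: h_eq rl_nn_rl_nn)
  also have "\<dots> = (\<integral>\<^sup>+s. ennreal (rl_kernel (3 - \<alpha>) (t - s)) * rl_nn (\<alpha> - 2) ?G s \<partial>lborel)"
    by (rule rl_nn_reflect) measurable
  also have "\<dots> = (\<integral>\<^sup>+s. (ennreal (rl_kernel (3 - \<alpha>) (t - s)) * rl_nn (\<alpha> - 2) ?G s) * indicator {0..t} s \<partial>lborel)"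
    by (intro nn_integral_cong) (auto simp: indicator_def rl_kernel_def rl_nn_eq_0)
  finally have "((\<lambda>s. enn2real (ennreal (rl_kernel (3 - \<alpha>) (t - s)) * rl_nn (\<alpha> - 2) ?G s)) has_integral h t) {0..t}"
    using h by (intro nn_integral_has_integral_enn2real) (auto simp: causal_def)
  then show ?thesis
    using assms by (simp add: enn2real_mult v_def)
qed

lemma nderiv_u_3:
  obtains N where "negligible N" "\<And>s. s \<in> {0<..<1} - N \<Longrightarrow> nderiv 3 u s = - v s"
proof -
  have "v integrable_on {0..1}" using has_integral_v[of 1] by auto
  then obtain N where N: "negligible N"
    "\<And>x. x \<in> {0<..<1} - N \<Longrightarrow> ((\<lambda>t. integral {0..t} v) has_real_derivative v x) (at x)"
    using indefinite_integral_has_derivative_AE by metis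
  show ?thesis
  proof (rule that[OF N(1)])
    fix s assume s: "s \<in> {0<..<1} - N"
    have "((\<lambda>t. integral {0..t} v) has_vector_derivative v s) (at s within {0..1})"
      using N(2)[OF s] by (auto simp: has_real_derivative_iff_has_vector_derivative intro: has_vector_derivative_at_within)
    from has_vector_derivative_minus[OF this]
    have "((\<lambda>t. - integral {0..t} v) has_vector_derivative - v s) (at s within {0..1})" .
    moreover have "nderiv 2 u t = - integral {0..t} v" if "t \<in> {0..1}" for t
      using that integral_unique[OF has_integral_v[OF that]] by (simp add: nderiv_u_2)
    ultimately show "nderiv 3 u s = - v s"
      using nderiv_has_vector_derivative(2)[of 2 u "\<lambda>t. - integral {0..t} v"] s by (simp add: numeral_3_eq_3)
  qed
qed

section \<open>Evaluation of the Caputo derivative\<close>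

lemma floor_order:
  assumes "\<alpha> < 3"
  shows "nat \<lfloor>\<alpha>\<rfloor> = 2" "\<alpha> \<notin> \<int>"
proof -
  have "\<lfloor>\<alpha>\<rfloor> = 2" using assms \<alpha> by (intro floor_unique) auto
  then show "nat \<lfloor>\<alpha>\<rfloor> = 2" "\<alpha> \<notin> \<int>"
    using \<alpha> by (auto simp: Ints_def)
qed

lemma has_integral_caputo_integrand:
  assumes "\<alpha> < 3" "t \<in> {0..1}"
  shows "(caputo_integrand \<alpha> u t has_integral - (Gamma (3 - \<alpha>) * h t)) {0..t}"
    and "caputo_integrand \<alpha> u t absolutely_integrable_on {0..t}"
proof -
  obtain N where N: "negligible N" "\<And>s. s \<in> {0<..<1} - N \<Longrightarrow> nderiv 3 u s = - v s"
    using nderiv_u_3 by metis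
  define w where "w s = Gamma (3 - \<alpha>) * (rl_kernel (3 - \<alpha>) (t - s) * v s)" for s
  have G: "Gamma (3 - \<alpha>) > 0" using assms by (intro Gamma_real_pos) auto
  have w: "(w has_integral (Gamma (3 - \<alpha>) * h t)) {0..t}"
    unfolding w_def[abs_def] using has_integral_mult_right[OF has_integral_kernel_v[OF assms]] .
  \<comment> \<open>Besides \<open>N\<close>, the end point 0, not covered by
    \<open>nderiv_u_3\<close>, and the singularity \<open>s = t\<close> of the kernel are left
    out.\<close>
  have neg: "negligible (insert 0 (insert t N))" using N(1) by simp
  have eq: "caputo_integrand \<alpha> u t s = - w s" if "s \<in> {0..t} - insert 0 (insert t N)" for s
  proof -
    have "0 < s" "s < t" "s \<in> {0<..<1} - N" using that assms(2) by auto
    then show ?thesis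
      using G N(2)[of s] floor_order[OF assms(1)]
      by (simp add: caputo_integrand_def w_def rl_kernel_def powr_minus[of _ "\<alpha> - 2", simplified] divide_inverse)
  qed
  show "(caputo_integrand \<alpha> u t has_integral - (Gamma (3 - \<alpha>) * h t)) {0..t}"
    by (rule has_integral_spike[OF neg eq has_integral_neg[OF w]])
  have "w absolutely_integrable_on {0..t}"
    using w G assms(1) by (intro nonnegative_absolutely_integrable_1) (auto simp: w_def)
  then have "(\<lambda>s. - w s) absolutely_integrable_on {0..t}"
    by (simp add: set_integrable_def)
  then show "caputo_integrand \<alpha> u t absolutely_integrable_on {0..t}"
    by (rule absolutely_integrable_spike[OF _ neg]) (use eq in auto)
qed

lemma caputo_u:
  assumes "t \<in> {0..1}"
  shows "caputo \<alpha> u t = - h t"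
proof (cases "\<alpha> = 3")
  case True
  then have "\<alpha> \<in> \<int>" "nat \<lfloor>\<alpha>\<rfloor> = 3" by auto
  then show ?thesis using nderiv_u_3_order_3(2)[OF True assms] by (simp add: caputo_def)
next
  case False
  with \<alpha> have a3: "\<alpha> < 3" by simp
  then have "Gamma (3 - \<alpha>) > 0" by (intro Gamma_real_pos) simp
  then have G: "Gamma (3 - \<alpha>) \<noteq> 0" by (rule less_imp_neq[symmetric])
  show ?thesis
    using integral_unique[OF has_integral_caputo_integrand(1)[OF a3 assms]]
    by (simp add: caputo_def floor_order[OF a3] G)
qed

lemma caputo_differentiable_u: "caputo_differentiable \<alpha> u"
proof -
  have diff: "nderiv k u differentiable_on {0..1}" if "k < 2" for k
  proof -
    consider "k = 0" | "k = 1" using \<open>k < 2\<close> by linarith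
    then show ?thesis
    proof cases
      case 1
      then show ?thesis
        by (auto simp: differentiable_on_def intro: differentiableI_vector[OF nderiv_u_1(1)])
    next
      case 2
      then show ?thesis
        by (auto simp: differentiable_on_def simp del: One_nat_def intro: differentiableI_vector[OF nderiv_u_2(1)])
    qed
  qed
  show ?thesis
  proof (cases "\<alpha> = 3")
    case True
    have "nderiv 2 u differentiable_on {0..1}"
      by (auto simp: differentiable_on_def intro: differentiableI_vector[OF nderiv_u_3_order_3(1)[OF True]])
    with diff have "nderiv k u differentiable_on {0..1}" if "k < 3" for k
      using that by (cases "k = 2") auto
    moreover have "\<alpha> \<in> \<int>" "nat \<lfloor>\<alpha>\<rfloor> = 3" using True by auto
    ultimately show ?thesis by (simp add: caputo_differentiable_def)
  next
    case False
    with \<alpha> have a3: "\<alpha> < 3" by simp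
    have "abs_continuous_on 0 1 (nderiv 2 u)"
    proof (rule abs_continuous_on_integral_bound[of v])
      show int: "v integrable_on {0..1}" using has_integral_v[of 1] by auto
      fix x y :: real assume xy: "0 \<le> x" "x \<le> y" "y \<le> 1"
      then have "integral {0..x} v + integral {x..y} v = integral {0..y} v"
        by (intro Henstock_Kurzweil_Integration.integral_combine integrable_on_subinterval[OF int]) auto
      then show "\<bar>nderiv 2 u y - nderiv 2 u x\<bar> \<le> integral {x..y} v"
        using xy integral_unique[OF has_integral_v[of x]] integral_unique[OF has_integral_v[of y]]
          integral_nonneg[OF integrable_on_subinterval[OF int, of x y]]
        by (simp add: nderiv_u_2)
    qed auto
    with diff show ?thesis
      using has_integral_caputo_integrand(2)[OF a3]
      by (simp add: caputo_differentiable_def floor_order[OF a3])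
  qed
qed

end

section \<open>The boundary value problem\<close>

text \<open>Split \<open>\<alpha> - s\<close> as \<open>(1 - s) + (\<alpha> - 1)\<close>. The two
  terms are the integrals of orders \<alpha> and \<open>\<alpha> - 1\<close> of the constant 1,
  taken at time 1, exactly those that occur in the bound for \<open>G\<close>.\<close>

lemma integral_\<Phi>:
  assumes "2 < \<alpha>"
  shows "integral {0..1} (\<Phi> \<alpha>) = 1 / Gamma (\<alpha> + 1) + 1 / Gamma \<alpha>"
proof -
  define F where "F s = - ((1 - s) powr \<alpha> / \<alpha> + (1 - s) powr (\<alpha> - 1)) / Gamma \<alpha>" for s
  have G: "Gamma \<alpha> \<noteq> 0" using assms by (intro less_imp_neq[symmetric] Gamma_real_pos) simp
  have "(\<Phi> \<alpha> has_integral F 1 - F 0) {0..1}"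
  proof (rule fundamental_theorem_of_calculus_interior)
    show "continuous_on {0..1} F"
      unfolding F_def using assms G
      by (intro continuous_on_divide continuous_on_minus continuous_on_add continuous_on_powr'
            continuous_on_diff continuous_on_const continuous_on_id) auto
    fix s :: real assume s: "s \<in> {0<..<1}"
    have "(F has_real_derivative ((1 - s) powr (\<alpha> - 1) + (\<alpha> - 1) * (1 - s) powr (\<alpha> - 2)) / Gamma \<alpha>) (at s)"
      unfolding F_def using s assms G
      by (auto intro!: derivative_eq_intros simp: field_simps)
    also have "((1 - s) powr (\<alpha> - 1) + (\<alpha> - 1) * (1 - s) powr (\<alpha> - 2)) / Gamma \<alpha> = \<Phi> \<alpha> s"
      using s powr_mult_base[of "1 - s" "\<alpha> - 2"] by (simp add: \<Phi>_def algebra_simps)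
    finally show "(F has_vector_derivative \<Phi> \<alpha> s) (at s)"
      by (simp add: has_real_derivative_iff_has_vector_derivative)
  qed simp
  then have "integral {0..1} (\<Phi> \<alpha>) = F 1 - F 0" by (rule integral_unique)
  also have "\<dots> = 1 / (\<alpha> * Gamma \<alpha>) + 1 / Gamma \<alpha>"
    using assms G by (simp add: F_def field_simps)
  also have "\<alpha> * Gamma \<alpha> = Gamma (\<alpha> + 1)"
    using assms by (intro Gamma_plus1[symmetric]) (auto elim!: nonpos_Ints_cases)
  finally show ?thesis .
qed

lemma plap_nonneg: "0 \<le> x \<Longrightarrow> plap p x = x powr (p - 1)"
  using powr_mult_base[of x "p - 2"] by (simp add: plap_def mult.commute)

lemma plap_minus: "plap p (- x) = - plap p x"
  by (simp add: plap_def)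

text \<open>With \<open>r = q - 1\<close> this presents \<open>h\<close> as a primitive. The gauge
  integral admits an exceptional point in the fundamental theorem, so integrability of the possibly
  unbounded integrand is part of the conclusion.\<close>

lemma powr_primitive_has_integral:
  fixes A w :: "real \<Rightarrow> real"
  assumes "0 \<le> t" "r > 0" "mono A" "A 0 = 0" "continuous_on {0..t} A"
    and deriv: "\<And>x. x \<in> {0<..<t} \<Longrightarrow> (A has_real_derivative w x) (at x)"
  shows "((\<lambda>x. r * A x powr (r - 1) * w x) has_integral A t powr r) {0..t}"
proof -
  have A_nonneg: "0 \<le> A x" if "0 \<le> x" for x
    using monoD[OF assms(3) that] assms(4) by simp
  \<comment> \<open>Since \<open>A\<close> is increasing and nonnegative, its zeros form an initial
    interval with supremum \<open>z\<close>.\<close>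
  define Z where "Z = {x \<in> {0..t}. A x = 0}"
  define z where "z = Sup Z"
  have Z: "0 \<in> Z" "bdd_above Z"
    using assms by (auto simp: Z_def intro: bdd_aboveI[of _ t])
  have "((\<lambda>x. r * A x powr (r - 1) * w x) has_integral A t powr r - A 0 powr r) {0..t}"
  \<comment> \<open>For \<open>r < 1\<close> the power of \<open>A\<close> need not be differentiable at the last zero \<open>z\<close> of \<open>A\<close>; before \<open>z\<close>
      both sides vanish because \<open>0 powr (r - 1) = 0\<close>.\<close>
  proof (rule fundamental_theorem_of_calculus_interior_strong[of "{z}"])
    show "continuous_on {0..t} (\<lambda>x. A x powr r)"
      using assms by (intro continuous_on_powr' continuous_intros) (auto intro: A_nonneg)
    fix x assume x: "x \<in> {0<..<t} - {z}"
    have "((\<lambda>x. A x powr r) has_real_derivative r * A x powr (r - 1) * w x) (at x)"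
    proof (cases "x < z")
      case True
      then obtain y where y: "y \<in> Z" "x < y"
        using less_cSup_iff[of Z x] Z by (auto simp: z_def)
      have zero: "A s = 0" if "s \<in> {0<..<y}" for s
        using monoD[OF assms(3), of s y] A_nonneg[of s] y(1) that by (auto simp: Z_def)
      have "((\<lambda>_. 0) has_real_derivative 0) (at x)" by simp
      then have "((\<lambda>x. A x powr r) has_real_derivative 0) (at x)"
        by (rule has_field_derivative_transform_within_open[of _ _ _ "{0<..<y}"])
           (use x y zero in auto)
      then show ?thesis using zero[of x] x y by simp
    next
      case False
      with x have "z < x" by simp
      then have "x \<notin> Z" using cSup_upper[of x Z] Z by (auto simp: z_def)
      then have "A x > 0" using A_nonneg[of x] x by (auto simp: Z_def)
      from DERIV_chain2[OF has_real_derivative_powr[OF this] deriv[of x]] x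
      show ?thesis by simp
    qed
    then show "((\<lambda>x. A x powr r) has_vector_derivative r * A x powr (r - 1) * w x) (at x)"
      by (simp add: has_real_derivative_iff_has_vector_derivative)
  qed (use assms in auto)
  then show ?thesis using assms by simp
qed

locale bvp_data =
  fixes p q \<alpha> \<eta> \<nu> L :: real
    and f :: "real \<Rightarrow> real \<Rightarrow> real"
    and a :: "real \<Rightarrow> real"
  assumes p: "p > 1" and pq: "1 / p + 1 / q = 1"
    and \<alpha>: "2 < \<alpha>" "\<alpha> \<le> 3" and \<eta>: "0 < \<eta>" "\<eta> < 1"
    and f_cont: "continuous_on ({0..1} \<times> {0..}) (\<lambda>(t, x). f t x)"
    and f_nonneg: "\<And>t x. t \<in> {0..1} \<Longrightarrow> x \<ge> 0 \<Longrightarrow> f t x \<ge> 0"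
    and f_0: "\<exists>t\<in>{0..1}. f t 0 \<noteq> 0"
    and a_cont: "continuous_on {0..1} a"
    and a_nonneg: "\<And>t. t \<in> {0..1} \<Longrightarrow> a t \<ge> 0"
    and a_nonzero: "\<And>c d. 0 \<le> c \<Longrightarrow> c < d \<Longrightarrow> d \<le> 1 \<Longrightarrow> \<exists>t\<in>{c..d}. a t \<noteq> 0"
    and \<nu>: "\<nu> > 0"
    and L_max: "\<And>t x. t \<in> {0..1} \<Longrightarrow> x \<in> {0..\<nu>} \<Longrightarrow> f t x \<le> L"
    and \<nu>_gt: "\<nu> > L powr (q - 1) * plap q (integral {0..1} a) * integral {0..1} (\<Phi> \<alpha>)"
begin

lemma q: "q > 1" "(q - 1) * (p - 1) = 1"
proof -
  have "q \<noteq> 0" using pq p by auto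
  then have eq: "q - 1 = 1 / (p - 1)" using pq p by (simp add: field_simps)
  then show "(q - 1) * (p - 1) = 1" using p by simp
  have "1 / (p - 1) > 0" using p by simp
  with eq show "q > 1" by linarith
qed

lemma L_nonneg: "L \<ge> 0"
  using L_max[of 0 0] f_nonneg[of 0 0] \<nu> by simp

text \<open>Clamping time extends all data constantly beyond \<open>[0, 1]\<close>, since the
  convolution calculus works on the whole line.\<close>

abbreviation cl :: "real \<Rightarrow> real" where
  "cl s \<equiv> max 0 (min 1 s)"

text \<open>Clamping \<open>u\<close> to \<open>[0, \<nu>]\<close> is harmless, since the fixed point takes its values there.\<close>

definition w :: "(real \<Rightarrow> real) \<Rightarrow> real \<Rightarrow> real" where
  "w u s = a (cl s) * f (cl s) (max 0 (min \<nu> (u (cl s))))"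

definition A :: "(real \<Rightarrow> real) \<Rightarrow> real \<Rightarrow> real" where
  "A u t = integral {0..cl t} (w u)"

definition h :: "(real \<Rightarrow> real) \<Rightarrow> real \<Rightarrow> real" where
  "h u t = A u t powr (q - 1)"

text \<open>The chain rule derivative of \<open>h u\<close>; for \<open>q < 2\<close> it may blow up
  as \<open>A u\<close> tends to 0, but it is 0 where \<open>A u\<close> is 0.\<close>

definition g :: "(real \<Rightarrow> real) \<Rightarrow> real \<Rightarrow> real" where
  "g u t = (q - 1) * A u t powr (q - 2) * w u t"

text \<open>A common bound for all \<open>h u\<close>, equal to the factor in front of the integral
  of \<open>\<Phi> \<alpha>\<close> in the hypothesis on \<nu>.\<close>

definition H :: real where
  "H = (L * integral {0..1} a) powr (q - 1)"

definition T :: "(real \<Rightarrow> real) \<Rightarrow> real \<Rightarrow> real" where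
  "T u = rl_integral \<alpha> (h u)"

definition G :: "(real \<Rightarrow> real) \<Rightarrow> real" where
  "G u = rl_integral \<alpha> (h u) 1 + rl_integral (\<alpha> - 1) (h u) 1 - rl_integral (\<alpha> - 1) (h u) \<eta>"

section \<open>Bounds, continuity and monotonicity of the source and its primitive\<close>

lemma w_nonneg [simp]: "0 \<le> w u s"
  unfolding w_def by (intro mult_nonneg_nonneg a_nonneg f_nonneg) auto

lemma w_le: "w u s \<le> L * a (cl s)"
  unfolding w_def mult.commute[of L] by (intro mult_left_mono a_nonneg L_max) (use \<nu> in auto)

lemma continuous_a_cl: "continuous_on S (\<lambda>s. a (cl s))"
  by (rule continuous_on_compose2[OF a_cont]) (auto intro!: continuous_intros)

lemma continuous_w:
  assumes "continuous_on {0..1} u"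
  shows "continuous_on S (w u)"
proof -
  have "continuous_on S (\<lambda>s. u (cl s))"
    by (rule continuous_on_compose2[OF assms]) (auto intro!: continuous_intros)
  then have "continuous_on S (\<lambda>s. (\<lambda>(t, x). f t x) (cl s, max 0 (min \<nu> (u (cl s)))))"
    by (intro continuous_on_compose2[OF f_cont] continuous_intros) auto
  then show ?thesis
    unfolding w_def[abs_def] by (intro continuous_intros continuous_a_cl) simp
qed

lemma integrable_w: "continuous_on {0..1} u \<Longrightarrow> w u integrable_on {c..d}"
  by (intro integrable_continuous_real continuous_w)

lemma A_has_derivative:
  assumes "continuous_on {0..1} u" "t \<in> {0..1}"
  shows "(A u has_vector_derivative w u t) (at t within {0..1})"
proof (rule has_vector_derivative_transform[OF assms(2)])
  show "((\<lambda>t. integral {0..t} (w u)) has_vector_derivative w u t) (at t within {0..1})"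
    by (intro integral_has_vector_derivative continuous_w assms)
qed (auto simp: A_def min_def max_def)

lemma A_has_real_derivative:
  assumes "continuous_on {0..1} u" "t \<in> {0<..<1}"
  shows "(A u has_real_derivative w u t) (at t)"
  using A_has_derivative[OF assms(1), of t] assms(2) at_within_interior[of t "{0..1::real}"]
  by (auto simp: has_real_derivative_iff_has_vector_derivative)

lemma A_cl: "A u (cl t) = A u t"
  by (simp add: A_def)

lemma continuous_A:
  assumes "continuous_on {0..1} u"
  shows "continuous_on S (A u)"
proof -
  have "continuous_on {0..1} (A u)"
    unfolding continuous_on_eq_continuous_within
    by (intro ballI has_vector_derivative_continuous[OF A_has_derivative[OF assms]])
  then have "continuous_on S (\<lambda>t. A u (cl t))"
    by (rule continuous_on_compose2) (auto intro!: continuous_intros)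
  then show ?thesis by (simp add: A_cl)
qed

lemma A_nonneg: "continuous_on {0..1} u \<Longrightarrow> 0 \<le> A u t"
  unfolding A_def by (intro integral_nonneg integrable_w) auto

lemma mono_A: "continuous_on {0..1} u \<Longrightarrow> mono (A u)"
  unfolding A_def by (intro monoI integral_subset_le integrable_w) auto

lemma A_eq_0: "t \<le> 0 \<Longrightarrow> A u t = 0"
  by (simp add: A_def)

lemma A_le:
  assumes "continuous_on {0..1} u"
  shows "A u t \<le> L * integral {0..1} a"
proof -
  have "A u t \<le> integral {0..1} (w u)"
    unfolding A_def by (intro integral_subset_le integrable_w assms) auto
  also have "\<dots> \<le> integral {0..1} (\<lambda>s. L * a (cl s))"
    by (intro integral_le integrable_w assms w_le integrable_continuous_real continuous_intros continuous_a_cl)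
  also have "\<dots> = L * integral {0..1} a"
    by (subst integral_mult_right[symmetric], rule integral_cong) auto
  finally show ?thesis .
qed

lemma h_nonneg [simp]: "0 \<le> h u t"
  by (simp add: h_def)

lemma causal_h:
  assumes "continuous_on {0..1} u"
  shows "causal (h u)"
  unfolding causal_def
proof (intro conjI allI impI)
  show "continuous_on UNIV (h u)"
    unfolding h_def[abs_def] using q assms
    by (intro continuous_on_powr' continuous_A continuous_intros) (auto simp: A_nonneg)
qed (auto simp: h_def A_eq_0)

lemma mono_h: "continuous_on {0..1} u \<Longrightarrow> mono (h u)"
  unfolding h_def using q(1) by (intro monoI powr_mono2 A_nonneg monoD[OF mono_A]) auto

lemma H_nonneg: "H \<ge> 0"
  by (simp add: H_def)

lemma h_le: "continuous_on {0..1} u \<Longrightarrow> h u t \<le> H"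
  unfolding h_def H_def using q(1) by (intro powr_mono2 A_nonneg A_le) auto

section \<open>Continuous dependence on \<open>u\<close>\<close>

lemma w_tendsto:
  assumes "\<And>t. t \<in> {0..1} \<Longrightarrow> (\<lambda>n. v n t) \<longlonglongrightarrow> u t"
  shows "(\<lambda>n. w (v n) s) \<longlonglongrightarrow> w u s"
proof -
  have "(\<lambda>n. max 0 (min \<nu> (v n (cl s)))) \<longlonglongrightarrow> max 0 (min \<nu> (u (cl s)))"
    by (intro tendsto_intros assms) auto
  moreover have "continuous_on {0..} (\<lambda>x. (\<lambda>(t, x). f t x) (cl s, x))"
    by (rule continuous_on_compose2[OF f_cont]) (auto intro!: continuous_intros)
  then have "continuous_on {0..} (f (cl s))" by simp
  ultimately have "(\<lambda>n. f (cl s) (max 0 (min \<nu> (v n (cl s))))) \<longlonglongrightarrow> f (cl s) (max 0 (min \<nu> (u (cl s))))"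
    by (auto simp: continuous_on_sequentially comp_def)
  then show ?thesis unfolding w_def by (intro tendsto_intros)
qed

lemma h_tendsto:
  assumes "\<And>n. continuous_on {0..1} (v n)" "continuous_on {0..1} u"
    and "\<And>t. t \<in> {0..1} \<Longrightarrow> (\<lambda>n. v n t) \<longlonglongrightarrow> u t"
  shows "(\<lambda>n. h (v n) t) \<longlonglongrightarrow> h u t"
proof -
  have "(\<lambda>n. A (v n) t) \<longlonglongrightarrow> A u t"
    unfolding A_def
  proof (rule dominated_convergence[where h = "\<lambda>s. L * a (cl s)"])
    show "(\<lambda>s. L * a (cl s)) integrable_on {0..cl t}"
      by (intro integrable_continuous_real continuous_intros continuous_a_cl)
    show "norm (w (v n) s) \<le> L * a (cl s)" for n s
      using w_le[of "v n" s] by simp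
  qed (auto intro: integrable_w assms w_tendsto)
  then show ?thesis
    unfolding h_def using q(1) A_nonneg assms by (intro tendsto_powr' tendsto_const) auto
qed

lemma rl_h_tendsto:
  assumes "\<beta> > 0" "\<And>n. continuous_on {0..1} (v n)" "continuous_on {0..1} u"
    and "\<And>t. t \<in> {0..1} \<Longrightarrow> (\<lambda>n. v n t) \<longlonglongrightarrow> u t"
  shows "(\<lambda>n. rl_integral \<beta> (h (v n)) t) \<longlonglongrightarrow> rl_integral \<beta> (h u) t"
  by (rule tendsto_rl_integral[where M = H]) (intro assms H_nonneg causal_h h_le h_tendsto)+

text \<open>As \<open>h u\<close> is increasing, so is its integral of order
  \<open>\<alpha> - 1\<close>, which gives the lower bound. For the upper bound drop the value at
  \<eta> and replace \<open>h u\<close> by \<open>H\<close>.\<close>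

lemma G_range:
  assumes "continuous_on {0..1} u"
  shows "G u \<in> {0..\<nu>}"
proof -
  note h = causal_h[OF assms]
  have "rl_integral (\<alpha> - 1) (h u) \<eta> \<le> rl_integral (\<alpha> - 1) (h u) 1"
    using \<alpha> \<eta> by (intro rl_integral_mono h mono_h assms) auto
  then have "0 \<le> G u" by (simp add: G_def add_nonneg_nonneg add.commute add_diff_eq[symmetric] del: add_diff_eq)
  moreover have "G u \<le> \<nu>"
  proof -
    have rl: "rl_integral \<beta> (h u) 1 \<le> H * rl_kernel (\<beta> + 1) 1" if "\<beta> > 0" for \<beta>
      using that h by (intro rl_integral_le H_nonneg h_le assms) (auto simp: causal_def)
    have "G u \<le> rl_integral \<alpha> (h u) 1 + rl_integral (\<alpha> - 1) (h u) 1"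
      by (simp add: G_def)
    also have "\<dots> \<le> H * rl_kernel (\<alpha> + 1) 1 + H * rl_kernel \<alpha> 1"
      using rl[of \<alpha>] rl[of "\<alpha> - 1"] \<alpha> by simp
    also have "\<dots> = H * integral {0..1} (\<Phi> \<alpha>)"
      using \<alpha> by (simp add: integral_\<Phi> rl_kernel_def distrib_left)
    also have "H = L powr (q - 1) * plap q (integral {0..1} a)"
      using L_nonneg integral_nonneg[OF integrable_continuous_real[OF a_cont] a_nonneg]
      by (simp add: H_def plap_nonneg powr_mult)
    finally show ?thesis using \<nu>_gt by simp
  qed
  ultimately show ?thesis by simp
qed

lemma volterra: "volterra_operator T G (H / Gamma \<alpha>) \<nu>"
proof
  fix u v :: "real \<Rightarrow> real" and s t :: real
  assume u: "continuous_on {0..1} u"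
  show "T u 0 = 0"
    unfolding T_def using causal_rl_integral[of \<alpha> "h u"] \<alpha> causal_h[OF u] by (auto simp: causal_def)
  show "G u \<in> {0..\<nu>}" by (rule G_range[OF u])
  show "\<bar>T u t - T u s\<bar> \<le> H / Gamma \<alpha> * \<bar>t - s\<bar>" if "s \<in> {0..1}" "t \<in> {0..1}"
    unfolding T_def
    using rl_integral_lipschitz[of "\<alpha> - 1" "h u" H s t] \<alpha> that H_nonneg causal_h[OF u] h_le[OF u] by simp
  show "T u t = T v t" if "t \<in> {0..1}" "\<And>s. s \<in> {0..t} \<Longrightarrow> u s = v s"
    unfolding T_def
  proof (rule rl_integral_cong)
    fix x assume "x < t"
    \<comment> \<open>For \<open>x < t\<close> the interval \<open>[0, cl x]\<close> lies in
      \<open>[0, t]\<close>, where \<open>u\<close> and \<open>v\<close> agree.\<close>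
    then have "w u s = w v s" if "s \<in> {0..cl x}" for s
      using that \<open>t \<in> {0..1}\<close> \<open>\<And>s. s \<in> {0..t} \<Longrightarrow> u s = v s\<close>
      by (auto simp: w_def)
    then show "h u x = h v x"
      unfolding h_def A_def by (metis (no_types, lifting) integral_cong)
  qed
next
  fix v :: "nat \<Rightarrow> real \<Rightarrow> real" and u :: "real \<Rightarrow> real" and t :: real
  assume *: "\<And>n. continuous_on {0..1} (v n)" "continuous_on {0..1} u"
    "\<And>t. t \<in> {0..1} \<Longrightarrow> (\<lambda>n. v n t) \<longlonglongrightarrow> u t"
  show "(\<lambda>n. T (v n) t) \<longlonglongrightarrow> T u t"
    unfolding T_def using \<alpha> by (intro rl_h_tendsto *) auto
  show "(\<lambda>n. G (v n)) \<longlonglongrightarrow> G u"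
    unfolding G_def using \<alpha> by (intro tendsto_add tendsto_diff rl_h_tendsto *) auto
next
  show "H / Gamma \<alpha> \<ge> 0" using H_nonneg \<alpha> Gamma_real_pos[of \<alpha>] by simp
qed

lemma h_primitive:
  assumes "continuous_on {0..1} u" "t \<le> 1"
  shows "ennreal (h u t) = rl_nn 1 (\<lambda>x. ennreal (g u x)) t"
proof -
  have "continuous_on UNIV (A u)" "continuous_on UNIV (w u)"
    using continuous_A continuous_w assms by auto
  note [measurable] = this[THEN borel_measurable_continuous_onI]
  have g: "g u \<in> borel_measurable borel" unfolding g_def[abs_def] by measurable
  then have [measurable]: "(\<lambda>x. ennreal (g u x)) \<in> borel_measurable borel" by simp
  have g_0: "g u x = 0" if "x \<le> 0" for x
    using that by (simp add: g_def A_eq_0)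
  have g_nonneg: "g u x \<ge> 0" for x
    using q(1) by (simp add: g_def)
  have "rl_nn 1 (\<lambda>x. ennreal (g u x)) t = (\<integral>\<^sup>+s. ennreal (g u s) * indicator {0..t} s \<partial>lborel)"
    by (rule rl_nn_one) (auto simp: g_0)
  also have "\<dots> = ennreal (h u t)"
  proof (cases "t \<ge> 0")
    case True
    have "((\<lambda>x. (q - 1) * A u x powr (q - 1 - 1) * w u x) has_integral A u t powr (q - 1)) {0..t}"
      using True q(1) assms
      by (intro powr_primitive_has_integral mono_A continuous_A A_has_real_derivative) (auto simp: A_eq_0)
    then have "(g u has_integral h u t) {0..t}"
      by (simp add: g_def[abs_def] h_def)
    with g_nonneg show ?thesis by (intro nn_integral_has_integral_lebesgue') auto
  next
    case False
    then show ?thesis by (simp add: h_def A_eq_0)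
  qed
  finally show ?thesis ..
qed

lemma caputo_potential_h:
  assumes "continuous_on {0..1} u"
  shows "caputo_potential \<alpha> (h u) (g u)"
proof
  have "continuous_on UNIV (A u)" "continuous_on UNIV (w u)"
    using continuous_A continuous_w assms by auto
  note [measurable] = this[THEN borel_measurable_continuous_onI]
  show "g u \<in> borel_measurable borel" unfolding g_def[abs_def] by measurable
qed (use \<alpha> assms in \<open>auto simp: g_def A_eq_0 causal_h h_primitive\<close>)

text \<open>The powers cancel because \<open>(q - 1) * (p - 1) = 1\<close>. Since the Caputo
  derivative of the solution is \<open>- h u\<close>, its p-Laplacian is the differentiable function
  \<open>- A u\<close>.\<close>

lemma plap_h:
  assumes "continuous_on {0..1} u"
  shows "plap p (- h u t) = - A u t"
  using q(2) A_nonneg[OF assms] by (simp add: plap_minus plap_nonneg h_def powr_powr)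

text \<open>Otherwise monotonicity makes \<open>h u\<close> vanish up to time 1, the fixed point is
  0, and \<open>a s * f s 0\<close> vanishes identically. Near a point with
  \<open>f t 0 \<noteq> 0\<close> this contradicts that \<open>a\<close> is nonzero somewhere in
  every subinterval.\<close>

lemma h_1_pos:
  assumes u: "continuous_on {0..1} u" "\<And>t. t \<in> {0..1} \<Longrightarrow> u t = G u - T u t"
  shows "h u 1 > 0"
proof (rule ccontr)
  assume "\<not> h u 1 > 0"
  then have "A u 1 = 0" using h_nonneg[of u 1] by (auto simp: h_def less_le)
  then have "integral {0..1} (w u) = 0" by (simp add: A_def)
  then have w0: "w u s = 0" if "s \<in> {0..1}" for s
    using integral_eq_0_iff[of 0 1 "w u"] continuous_w[OF u(1)] that by auto
  have "A u t = 0" if "t \<le> 1" for t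
    using monoD[OF mono_A[OF u(1)] that] \<open>A u 1 = 0\<close> A_nonneg[OF u(1), of t] by simp
  then have "h u t = 0" if "t \<le> 1" for t using that by (simp add: h_def)
  then have "rl_integral \<beta> (h u) t \<le> 0" if "\<beta> > 0" "t \<le> 1" for \<beta> t
    using rl_integral_le[of \<beta> 0 t "h u"] that by auto
  then have "rl_integral \<beta> (h u) t = 0" if "\<beta> > 0" "t \<le> 1" for \<beta> t
    using that by (simp add: order_antisym)
  then have u0: "u t = 0" if "t \<in> {0..1}" for t
    using u(2)[OF that] that \<alpha> \<eta> by (simp add: G_def T_def)
  have af: "a s * f s 0 = 0" if "s \<in> {0..1}" for s
    using w0[OF that] that u0[OF that] \<nu> by (simp add: w_def)
  obtain t where t: "t \<in> {0..1}" "f t 0 \<noteq> 0" using f_0 by blast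
  have "continuous_on {0..1} (\<lambda>s. (\<lambda>(t, x). f t x) (s, 0))"
    by (rule continuous_on_compose2[OF f_cont]) (auto intro!: continuous_intros)
  then have "continuous_on {0..1} (\<lambda>s. f s 0)" by simp
  then obtain d where d: "d > 0" "\<And>s. s \<in> {0..1} \<Longrightarrow> dist s t < d \<Longrightarrow> dist (f s 0) (f t 0) < \<bar>f t 0\<bar>"
    using t unfolding continuous_on_iff by (metis zero_less_abs_iff)
  \<comment> \<open>Half the radius keeps the closed interval inside the neighbourhood where
    \<open>f s 0\<close> is nonzero.\<close>
  define x y where "x = max 0 (t - d / 2)" and "y = min 1 (t + d / 2)"
  have "0 \<le> x" "x < y" "y \<le> 1" using t d(1) by (auto simp: x_def y_def)
  then obtain s where s: "s \<in> {x..y}" "a s \<noteq> 0" using a_nonzero by blast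
  with t d(1) have "s \<in> {0..1}" "dist s t < d" by (auto simp: x_def y_def dist_real_def)
  from d(2)[OF this] af[OF this(1)] s(2) show False by (simp add: dist_real_def)
qed

theorem positive_solution: "\<exists>u. positive_bvp_solution p \<alpha> \<eta> f a u"
proof -
  interpret volterra_operator T G "H / Gamma \<alpha>" \<nu> by (rule volterra)
  obtain u where u: "continuous_on {0..1} u" "\<And>t. t \<in> {0..1} \<Longrightarrow> u t = G u - T u t"
    using fixed_point \<nu> by (metis less_imp_le)
  interpret U: caputo_potential \<alpha> "G u" "h u" "g u" by (rule caputo_potential_h[OF u(1)])
  have U: "U.u t = u t" if "t \<in> {0..1}" for t
    using u(2)[OF that] by (simp add: U.u_def T_def)
  have h: "causal (h u)" by (rule causal_h[OF u(1)])
  have rl_0: "rl_integral \<beta> (h u) 0 = 0" if "\<beta> > 0" for \<beta>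
    using causal_rl_integral[OF that h] by (simp add: causal_def)
  \<comment> \<open>\<open>U.u\<close> is smallest at time 1, where its value is the integral of
    \<open>?r\<close> over \<open>[\<eta>, 1]\<close>. This is positive because \<open>?r\<close> is
    continuous, nonnegative and positive at 1.\<close>
  have pos: "U.u t > 0" if t: "t \<in> {0..1}" for t
  proof -
    let ?r = "rl_integral (\<alpha> - 2) (h u)"
    have "causal ?r" using \<alpha> h by (intro causal_rl_integral) auto
    then have r: "continuous_on {\<eta>..1} ?r" by (rule causal_continuous_on)
    have "?r 1 > 0" using \<alpha> h h_1_pos[OF u] by (intro rl_integral_pos) auto
    then have "integral {\<eta>..1} ?r \<noteq> 0"
      using integral_eq_0_iff[OF r] \<eta> by auto
    moreover have "integral {\<eta>..1} ?r \<ge> 0"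
      by (intro integral_nonneg integrable_continuous_real r) simp
    moreover have "rl_integral (\<alpha> - 1) (h u) 1 - rl_integral (\<alpha> - 1) (h u) \<eta> = integral {\<eta>..1} ?r"
      using rl_integral_diff[of "\<alpha> - 2" "h u" \<eta> 1] \<alpha> \<eta> h by simp
    moreover have "rl_integral \<alpha> (h u) t \<le> rl_integral \<alpha> (h u) 1"
      using \<alpha> t by (intro rl_integral_mono h mono_h u(1)) auto
    ultimately show ?thesis using U.u_def[of t] G_def[of u] by linarith
  qed
  have le: "U.u t \<le> \<nu>" for t
    using G_range[OF u(1)] rl_integral_nonneg[of \<alpha> "h u" t] by (simp add: U.u_def del: rl_integral_nonneg)
  have cap: "caputo \<alpha> U.u t = - h u t" if "t \<in> {0..1}" for t
    using U.caputo_u[OF that] .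
  have "bvp_solution p \<alpha> \<eta> f a U.u"
    unfolding bvp_solution_def
  proof (intro conjI ballI)
    show "caputo_differentiable \<alpha> U.u" by (rule U.caputo_differentiable_u)
    have "continuous_on {0..1} (\<lambda>t. - h u t)"
      by (intro continuous_intros causal_continuous_on h)
    then show "continuous_on {0..1} (caputo \<alpha> U.u)"
      by (rule continuous_on_eq) (simp add: cap)
    show "caputo \<alpha> U.u 0 = 0" using h by (simp add: cap causal_def)
    show "nderiv 1 U.u 0 = 0" "nderiv 2 U.u 0 = 0"
      using \<alpha> by (simp_all add: U.nderiv_u_1(2) U.nderiv_u_2(2) rl_0 del: One_nat_def)
    \<comment> \<open>This condition, solved for the additive constant of \<open>U.u\<close>, is the
      definition of \<open>G u\<close>.\<close>
    show "U.u 1 + nderiv 1 U.u 1 = nderiv 1 U.u \<eta>"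
      using U.nderiv_u_1(2)[of 1] U.nderiv_u_1(2)[of \<eta>] \<eta> U.u_def[of 1] G_def[of u] by simp
    fix t :: real assume t: "t \<in> {0<..<1}"
    have "((\<lambda>s. - A u s) has_real_derivative - w u t) (at t)"
      by (intro DERIV_minus A_has_real_derivative u(1) t)
    then have D: "((\<lambda>s. plap p (caputo \<alpha> U.u s)) has_real_derivative - w u t) (at t)"
      by (rule has_field_derivative_transform_within_open[of _ _ _ "{0<..<1}"])
         (use t in \<open>auto simp: cap plap_h[OF u(1)]\<close>)
    show "(\<lambda>s. plap p (caputo \<alpha> U.u s)) differentiable at t"
      using D by (auto simp: real_differentiable_def)
    \<comment> \<open>The bounds \<open>0 < U.u t\<close> and \<open>U.u t \<le> \<nu>\<close> make
      both clamps in \<open>w\<close> inactive.\<close>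
    have "w u t = a t * f t (U.u t)"
      using t pos[of t] le[of t] U[of t] by (simp add: w_def)
    then show "deriv (\<lambda>s. plap p (caputo \<alpha> U.u s)) t + a t * f t (U.u t) = 0"
      using DERIV_imp_deriv[OF D] by simp
  qed
  moreover have "continuous_on {0..1} U.u"
    by (rule continuous_on_eq[OF u(1)]) (simp add: U)
  ultimately show ?thesis
    unfolding positive_bvp_solution_def using pos by (intro exI[of _ U.u]) auto
qed

end

theorem theorem3p3:
  fixes p q \<alpha> \<eta> \<nu> L :: real
    and f :: "real \<Rightarrow> real \<Rightarrow> real"
    and a :: "real \<Rightarrow> real"
  assumes "p > 1" and "1 / p + 1 / q = 1"
    and "2 < \<alpha>" and "\<alpha> \<le> 3" and "0 < \<eta>" and "\<eta> < 1"
    and "continuous_on ({0..1} \<times> {0..}) (\<lambda>(t, x). f t x)"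
    and "\<And>t x. t \<in> {0..1} \<Longrightarrow> x \<ge> 0 \<Longrightarrow> f t x \<ge> 0"
    and "\<exists>t\<in>{0..1}. f t 0 \<noteq> 0"
    and "continuous_on {0..1} a"
    and "\<And>t. t \<in> {0..1} \<Longrightarrow> a t \<ge> 0"
    and "\<And>c d. 0 \<le> c \<Longrightarrow> c < d \<Longrightarrow> d \<le> 1 \<Longrightarrow> \<exists>t\<in>{c..d}. a t \<noteq> 0"
    and "\<nu> > 0"
    and L_attained: "\<exists>t\<in>{0..1}. \<exists>x\<in>{0..\<nu>}. f t x = L"
    and L_max: "\<And>t x. t \<in> {0..1} \<Longrightarrow> x \<in> {0..\<nu>} \<Longrightarrow> f t x \<le> L"
    and "\<nu> > L powr (q - 1) * plap q (integral {0..1} a) * integral {0..1} (\<Phi> \<alpha>)"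
  shows "\<exists>u. positive_bvp_solution p \<alpha> \<eta> f a u"
proof -
  interpret bvp_data p q \<alpha> \<eta> \<nu> L f a
    by unfold_locales (use assms in auto)
  show ?thesis by (rule positive_solution)
qed

end
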